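(* For every $R>0$ and every $r,j\in\mathbb{N}_0$ one has, for $f\in L^2(\mathbb{R})$ and $z\in\mathbb{R}^2$, $$V_{h_r}f(z)=C_{j,r}(R)^{-1}\int_{z+D_R}V_{h_r}f(w)\,K_{h_j}(z,w)\,dw ,$$ with $$C_{j,r}(R):=\langle\chi_{D_R}\cdot V_{h_r}h_r,V_{h_j}h_j\rangle=\int_0^{\pi R^2}L_r^0(t)L_j^0(t)e^{-t}dt .$$
   Context: For $z=(x,\xi)\in\mathbb{R}^2$ put $\pi(z)g(t)=e^{2\pi i\xi t}g(t-x)$. The short-time Fourier transform of $f\in L^2(\mathbb{R})$ with window $g\in L^2(\mathbb{R})$ is $V_gf(z)=\langle f,\pi(z)g\rangle=\int_{\mathbb{R}}f(t)\overline{g(t-x)}e^{-2\pi i\xi t}dt$ (inner products are linear in the first argument; the inner product defining $C_{j,r}(R)$ is that of $L^2(\mathbb{R}^2)$). The kernel is $K_g(z,w)=\langle\pi(w)g,\pi(z)g\rangle$. The Hermite functions are $h_r(t)=\frac{2^{1/4}}{\sqrt{r!}}\left(\frac{-1}{2\sqrt{\pi}}\right)^{r}e^{\pi t^2}\frac{d^r}{dt^r}\left(e^{-2\pi t^2}\right)$, $r\ge0$; they form an orthonormal basis of $L^2(\mathbb{R})$. $L_r^0(x)=\sum_{i=0}^r(-1)^i\binom{r}{i}\frac{x^i}{i!}$ is the Laguerre polynomial. $D_R\subset\mathbb{R}^2$ is the disc of radius $R$ centered at $0$, and $\chi_{D_R}$ is its indicator function.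
   Formalization: The reproducing formula is stated only when C_{j,r}(R) is nonzero, since C_{j,r}(R)^{-1} is otherwise undefined (e.g. r=0, j=2, πR²=2 gives C=0); the Laguerre formula for C_{j,r}(R) is stated for all R>0, r, j. *)

theory Defs
  imports "HOL-Analysis.Analysis"
begin

text \<open>Elements of $L^2$ are represented by Lebesgue measurable functions (not by
  equivalence classes); the phase space is the type of pairs, whose norm is Euclidean.\<close>

definition L2 :: "('a::euclidean_space \<Rightarrow> complex) set" where
  "L2 = {f \<in> borel_measurable lebesgue. integrable lebesgue (\<lambda>x. (cmod (f x))\<^sup>2)}"

definition L2_inner :: "('a::euclidean_space \<Rightarrow> complex) \<Rightarrow> ('a \<Rightarrow> complex) \<Rightarrow> complex" where
  "L2_inner f g = (LINT x|lebesgue. f x * cnj (g x))"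

definition tf_shift :: "real \<times> real \<Rightarrow> (real \<Rightarrow> complex) \<Rightarrow> real \<Rightarrow> complex" where
  "tf_shift z g = (\<lambda>t. exp (2 * pi * \<i> * snd z * t) * g (t - fst z))"

definition stft :: "(real \<Rightarrow> complex) \<Rightarrow> (real \<Rightarrow> complex) \<Rightarrow> real \<times> real \<Rightarrow> complex" where
  "stft g f z = L2_inner f (tf_shift z g)"

definition stft_kernel ::
    "(real \<Rightarrow> complex) \<Rightarrow> real \<times> real \<Rightarrow> real \<times> real \<Rightarrow> complex" where
  "stft_kernel g z w = L2_inner (tf_shift w g) (tf_shift z g)"

definition hermite_fun :: "nat \<Rightarrow> real \<Rightarrow> complex" where
  "hermite_fun r t = complex_of_real
     (2 powr (1/4) / sqrt (fact r) * (- 1 / (2 * sqrt pi)) ^ r * exp (pi * t\<^sup>2)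
       * (deriv ^^ r) (\<lambda>s. exp (- 2 * pi * s\<^sup>2)) t)"

definition laguerre :: "nat \<Rightarrow> real \<Rightarrow> real" where
  "laguerre r x = (\<Sum>i\<le>r. (- 1) ^ i * real (r choose i) * x ^ i / fact i)"

definition disc :: "real \<Rightarrow> (real \<times> real) set" where
  "disc R = ball 0 R"

definition local_const :: "nat \<Rightarrow> nat \<Rightarrow> real \<Rightarrow> complex" where
  "local_const j r R =
     L2_inner (\<lambda>w. indicator (disc R) w * stft (hermite_fun r) (hermite_fun r) w)
              (stft (hermite_fun j) (hermite_fun j))"

end

theory Submission
  imports Defs "HOL-Probability.Characteristic_Functions" "HOL-Complex_Analysis.Cauchy_Integral_Formula"
    "HOL-Real_Asymp.Real_Asymp"
begin

text \<open>
Write the points of $z + D_R$ as $z + u$ with $u\in D_R$. Since $\pi(z+u)$ is $\pi(z)\pi(u)$ up to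
a phase, this phase appears in $K_{h_j}(z,z+u)$ and, conjugated, in $V_{h_r}f(z+u)$. By Fubini the
integral over $z + D_R$ is therefore the pairing of $f$ with $\pi(z)$ applied to
$\int_{D_R} \overline{\langle\pi(u)h_j,h_j\rangle}\,\pi(u)h_r\,du$, and everything rests on the
claim that this function is $C_{j,r}(R)\,h_r$. The claim is proved pointwise, in conjugated form
(\<open>disc_synthesis_hermite\<close>).

Two computations give it. First, $\langle\pi(u)h_j,h_j\rangle$ is the phase $e^{i\pi x\xi}$ times
$L_j(\pi|u|^2)\,e^{-\pi|u|^2/2}$ for $u = (x,\xi)$; this is a Gaussian integral of a product of two
Hermite polynomials, evaluated by repeated integration by parts
(\<open>hermite_moment_diagonal\<close>). Secondly, with this phase included, $\overline{\pi(u)h_r(t)}$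
is, up to a radial factor in $u$ and a factor in $t$, the function
$e^{yw - w^2/2}\,H_r(y - w - \overline{w})$, where $H_r$ is a Hermite polynomial, $y = 2\sqrt{\pi}\,t$ and
$w = \sqrt{\pi}(x - i\xi)$. By Cauchy's formula its mean over a circle $|w|^2 = q$ is
$L_r(q)\,H_r(y)$ (\<open>circle_mean_hermite\<close>). The disc is a union of such circles, and the
weight is radial; the passage from circles to the disc uses that area is invariant under rotations
(\<open>integral_eq_rotation_average\<close>).

Hence the integral over the disc is $h_r(t)$ times the integral of
$L_j(q)\,L_r(q)\,e^{-q}$ with $q = \pi|u|^2$. Because the disc of radius $R$ has area $\pi R^2$,
the image of area under $u \mapsto \pi|u|^2$ is length on $[0,\pi R^2]$, which gives the
one-dimensional formula for $C_{j,r}(R)$.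
\<close>

section \<open>Hermite polynomials\<close>

text \<open>The Hermite polynomials of probability theory: $1, x, x^2 - 1, \<dots>$, orthogonal for the
weight $e^{-x^2/2}$. They are needed over the reals, where they describe the Hermite functions, and
over the complex numbers, where Cauchy's formula applies to them.\<close>

fun hermite_poly :: "nat \<Rightarrow> 'a::real_normed_field \<Rightarrow> 'a" where
  "hermite_poly 0 x = 1"
| "hermite_poly (Suc 0) x = x"
| "hermite_poly (Suc (Suc n)) x = x * hermite_poly (Suc n) x - of_nat (Suc n) * hermite_poly n x"

lemma hermite_poly_Suc:
  "hermite_poly (Suc n) x = x * hermite_poly n x - of_nat n * hermite_poly (n - 1) x"
  by (cases n) auto

lemma hermite_poly_of_real: "hermite_poly n (of_real x) = of_real (hermite_poly n x)"
  by (induction n x rule: hermite_poly.induct) auto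

lemma has_field_derivative_hermite_poly:
  "(hermite_poly n has_field_derivative of_nat n * hermite_poly (n - 1) x) (at x)"
proof (induction n x rule: hermite_poly.induct)
  case (3 n x)
  have "((\<lambda>x. x * hermite_poly (Suc n) x - of_nat (Suc n) * hermite_poly n x) has_field_derivative
      (x * (of_nat (Suc n) * hermite_poly n x) + hermite_poly (Suc n) x)
        - of_nat (Suc n) * (of_nat n * hermite_poly (n - 1) x)) (at x)"
    using 3 by (auto intro!: derivative_eq_intros)
  also have "(x * (of_nat (Suc n) * hermite_poly n x) + hermite_poly (Suc n) x)
        - of_nat (Suc n) * (of_nat n * hermite_poly (n - 1) x) =
      of_nat (Suc (Suc n)) * hermite_poly (Suc n) x"
    unfolding hermite_poly_Suc[of n] by (simp add: algebra_simps)
  finally show ?case by simp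
qed (auto intro!: derivative_eq_intros)

lemmas has_field_derivative_hermite_poly' [derivative_intros] =
  DERIV_chain2[OF has_field_derivative_hermite_poly]

lemma continuous_on_hermite_poly [continuous_intros]:
  fixes f :: "'b::topological_space \<Rightarrow> 'a::real_normed_field"
  assumes "continuous_on A f"
  shows "continuous_on A (\<lambda>x. hermite_poly n (f x))"
proof -
  have "continuous_on UNIV (hermite_poly n :: 'a \<Rightarrow> 'a)"
    by (meson DERIV_isCont continuous_at_imp_continuous_on has_field_derivative_hermite_poly)
  then show ?thesis
    using assms continuous_on_compose2 by blast
qed

lemma hermite_poly_gaussian_deriv:
  fixes x :: "'a::{real_normed_field,banach}"
  shows "((\<lambda>x. hermite_poly n x * exp (- x\<^sup>2 / 2)) has_field_derivative
           - hermite_poly (Suc n) x * exp (- x\<^sup>2 / 2)) (at x)"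
  by (rule derivative_eq_intros refl | simp)+
    (simp add: hermite_poly_Suc algebra_simps)

text \<open>This is the Taylor expansion of $H_n$ at $x$, because $H_n' = n H_{n-1}$. The three-term recursion
reaches back two degrees, hence the strong induction.\<close>

lemma hermite_poly_add:
  "hermite_poly n (x + y) = (\<Sum>k\<le>n. of_nat (n choose k) * y ^ k * hermite_poly (n - k) x)"
proof (induction n rule: less_induct)
  case (less n)
  show ?case
  proof (cases n)
    case 0
    then show ?thesis by simp
  next
    case (Suc m)
    have IH: "hermite_poly m (x + y) = (\<Sum>k\<le>m. of_nat (m choose k) * y ^ k * hermite_poly (m - k) x)"
      using less Suc by simp
    have IH': "of_nat m * hermite_poly (m - 1) (x + y) =
        (\<Sum>k\<le>m. of_nat (m choose k) * y ^ k * (of_nat (m - k) * hermite_poly (m - k - 1) x))"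
    proof (cases m)
      case (Suc l)
      have "of_nat (Suc l) * hermite_poly l (x + y) =
        (\<Sum>k\<le>l. of_nat (Suc l * (l choose k)) * y ^ k * hermite_poly (l - k) x)"
        using less \<open>n = Suc m\<close> Suc by (simp only: of_nat_mult) (simp add: sum_distrib_left mult.assoc del: of_nat_Suc)
      also have "\<dots> = (\<Sum>k\<le>l. of_nat (Suc l choose k) * y ^ k * (of_nat (Suc l - k) * hermite_poly (Suc l - k - 1) x))"
      proof (rule sum.cong)
        fix k assume "k \<in> {..l}"
        then have "Suc l * (l choose k) = (Suc l choose k) * (Suc l - k)"
          using binomial_absorb_comp[of "Suc l" k] by (simp add: mult.commute)
        then show "of_nat (Suc l * (l choose k)) * y ^ k * hermite_poly (l - k) x =
          of_nat (Suc l choose k) * y ^ k * (of_nat (Suc l - k) * hermite_poly (Suc l - k - 1) x)"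
          by (simp only: of_nat_mult) (use \<open>k \<in> {..l}\<close> in \<open>simp add: Suc_diff_le ac_simps\<close>)
      qed simp
      also have "\<dots> = (\<Sum>k\<le>Suc l. of_nat (Suc l choose k) * y ^ k * (of_nat (Suc l - k) * hermite_poly (Suc l - k - 1) x))"
        by simp
      finally show ?thesis using Suc by simp
    qed simp
    have "hermite_poly n (x + y) = (x + y) * hermite_poly m (x + y) - of_nat m * hermite_poly (m - 1) (x + y)"
      unfolding Suc by (rule hermite_poly_Suc)
    also have "\<dots> = y * hermite_poly m (x + y) +
        (\<Sum>k\<le>m. of_nat (m choose k) * y ^ k * hermite_poly (Suc (m - k)) x)"
      unfolding IH' unfolding IH hermite_poly_Suc
      by (simp add: algebra_simps sum_distrib_left sum_subtractf sum.distrib)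
    also have "y * hermite_poly m (x + y) = (\<Sum>k\<le>m. of_nat (m choose k) * y ^ Suc k * hermite_poly (m - k) x)"
      unfolding IH by (simp add: sum_distrib_left ac_simps)
    also have "(\<Sum>k\<le>m. of_nat (m choose k) * y ^ k * hermite_poly (Suc (m - k)) x) =
        hermite_poly n x + (\<Sum>k\<le>m. of_nat (m choose Suc k) * y ^ Suc k * hermite_poly (m - k) x)"
    proof -
      have "(\<Sum>k\<le>m. of_nat (m choose k) * y ^ k * hermite_poly (Suc (m - k)) x) =
          (\<Sum>k\<le>m. of_nat (m choose k) * y ^ k * hermite_poly (Suc m - k) x)"
        by (rule sum.cong) (auto simp: Suc_diff_le)
      also have "\<dots> = (\<Sum>k\<le>Suc m. of_nat (m choose k) * y ^ k * hermite_poly (Suc m - k) x)"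
        by simp
      also have "\<dots> = hermite_poly n x + (\<Sum>k\<le>m. of_nat (m choose Suc k) * y ^ Suc k * hermite_poly (m - k) x)"
        unfolding sum.atMost_Suc_shift Suc by simp
      finally show ?thesis .
    qed
    also have "(\<Sum>k\<le>m. of_nat (m choose k) * y ^ Suc k * hermite_poly (m - k) x) +
        (hermite_poly n x + (\<Sum>k\<le>m. of_nat (m choose Suc k) * y ^ Suc k * hermite_poly (m - k) x)) =
        hermite_poly n x + (\<Sum>k\<le>m. of_nat (Suc m choose Suc k) * y ^ Suc k * hermite_poly (m - k) x)"
      by (simp add: sum.distrib[symmetric] algebra_simps)
    also have "\<dots> = (\<Sum>k\<le>n. of_nat (n choose k) * y ^ k * hermite_poly (n - k) x)"
      unfolding Suc sum.atMost_Suc_shift by simp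
    finally show ?thesis .
  qed
qed

text \<open>A crude exponential bound is as good as a polynomial one against a Gaussian, and it survives
products without any bookkeeping of degrees.\<close>

lemma hermite_poly_bound:
  fixes b :: complex
  shows "\<exists>C\<ge>0. \<forall>y::real. norm (hermite_poly n (of_real y + b)) \<le> C * exp (real n * \<bar>y\<bar>)"
proof (induction n "0::real" rule: hermite_poly.induct)
  have aff: "norm (of_real y + b) \<le> (1 + norm b) * exp \<bar>y\<bar>" for y :: real
  proof -
    have "norm (of_real y + b) \<le> \<bar>y\<bar> + norm b" by (metis norm_of_real norm_triangle_ineq)
    also have "\<dots> \<le> exp \<bar>y\<bar> + norm b * exp \<bar>y\<bar>"
      by (intro add_mono mult_left_mono[of 1 "exp \<bar>y\<bar>" "norm b", simplified])
         (use exp_ge_add_one_self[of "\<bar>y\<bar>"] in linarith)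
    finally show ?thesis by (simp add: algebra_simps)
  qed
  case 1
  show ?case by (rule exI[of _ 1]) auto
  case 2
  show ?case by (rule exI[of _ "1 + norm b"]) (use aff in auto)
  case (3 n)
  then obtain C D where C: "C \<ge> 0" "\<And>y::real. norm (hermite_poly (Suc n) (of_real y + b)) \<le> C * exp (real (Suc n) * \<bar>y\<bar>)"
    and D: "D \<ge> 0" "\<And>y::real. norm (hermite_poly n (of_real y + b)) \<le> D * exp (real n * \<bar>y\<bar>)"
    by blast
  have "norm (hermite_poly (Suc (Suc n)) (of_real y + b)) \<le>
     ((1 + norm b) * C + real (Suc n) * D) * exp (real (Suc (Suc n)) * \<bar>y\<bar>)" for y :: real
  proof -
    have "norm (hermite_poly (Suc (Suc n)) (of_real y + b)) \<le>
       norm (of_real y + b) * norm (hermite_poly (Suc n) (of_real y + b))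
         + real (Suc n) * norm (hermite_poly n (of_real y + b))"
      by (simp only: hermite_poly.simps norm_mult[symmetric] norm_of_nat[symmetric, where 'a=complex] norm_triangle_ineq4)
    also have "\<dots> \<le> ((1 + norm b) * exp \<bar>y\<bar>) * (C * exp (real (Suc n) * \<bar>y\<bar>))
        + real (Suc n) * (D * exp (real n * \<bar>y\<bar>))"
      by (intro add_mono mult_mono aff C D) (auto intro: C D)
    also have "\<dots> \<le> ((1 + norm b) * C) * exp (real (Suc (Suc n)) * \<bar>y\<bar>)
        + real (Suc n) * (D * exp (real (Suc (Suc n)) * \<bar>y\<bar>))"
    proof (intro add_mono mult_left_mono)
      show "((1 + norm b) * exp \<bar>y\<bar>) * (C * exp (real (Suc n) * \<bar>y\<bar>))
        \<le> ((1 + norm b) * C) * exp (real (Suc (Suc n)) * \<bar>y\<bar>)"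
        by (simp add: exp_add[symmetric] algebra_simps)
    qed (use C D in \<open>auto intro!: mult_right_mono\<close>)
    finally show ?thesis by (simp add: algebra_simps)
  qed
  then show ?case using C(1) D(1)
    by (intro exI[of _ "(1 + norm b) * C + real (Suc n) * D"]) auto
qed

section \<open>Gaussian integrals of products of Hermite polynomials\<close>

text \<open>Substituting $y \mapsto y + \mathrm{Re}\,c$ removes the real part of $c$ from the exponent;
what remains is the characteristic function of the normal distribution.\<close>

lemma gaussian_mgf:
  fixes c :: complex
  shows "has_bochner_integral lborel (\<lambda>y::real. exp (c * y - y\<^sup>2 / 2)) (sqrt (2 * pi) * exp (c\<^sup>2 / 2))"
proof -
  define a where "a = Re c"
  define v where "v = Im c"
  have c: "c = of_real a + \<i> * of_real v" by (simp add: a_def v_def complex_eq_iff)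
  have "(LINT y|lborel. std_normal_density y *\<^sub>R iexp (v * y)) = char std_normal_distribution v"
    unfolding char_def by (subst integral_density) auto
  also have "\<dots> = exp (- v\<^sup>2 / 2)"
    by (simp add: char_std_normal_distribution)
  finally have char: "(LINT y|lborel. std_normal_density y *\<^sub>R iexp (v * y)) = exp (- v\<^sup>2 / 2)" .
  have int: "integrable lborel (\<lambda>y. std_normal_density y *\<^sub>R iexp (v * y))"
    by (rule Bochner_Integration.integrable_bound[OF integrable_normal_density[of 1 0]])
      (auto simp: norm_mult)
  have *: "has_bochner_integral lborel (\<lambda>y. (exp (c * a - a\<^sup>2 / 2) * sqrt (2 * pi)) * (std_normal_density y *\<^sub>R iexp (v * y)))
        ((exp (c * a - a\<^sup>2 / 2) * sqrt (2 * pi)) * exp (- v\<^sup>2 / 2))"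
    using int char by (intro has_bochner_integral_mult_right) (simp add: has_bochner_integral_iff)
  have eq: "(exp (c * a - a\<^sup>2 / 2) * sqrt (2 * pi)) * (std_normal_density y *\<^sub>R iexp (v * y)) =
      exp (c * (a + 1 * y) - (a + 1 * y)\<^sup>2 / 2)" for y :: real
  proof -
    have "(exp (c * a - a\<^sup>2 / 2) * sqrt (2 * pi)) * (std_normal_density y *\<^sub>R iexp (v * y)) =
      exp (c * a - a\<^sup>2 / 2) * (exp (- (of_real y)\<^sup>2 / 2) * exp (\<i> * (v * y)))"
      by (simp add: std_normal_density_def scaleR_conv_of_real exp_of_real[symmetric] del: exp_of_real)
    also have "\<dots> = exp (c * a - a\<^sup>2 / 2 + (- (of_real y)\<^sup>2 / 2 + \<i> * (v * y)))"
      by (simp only: exp_add)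
    also have "c * a - a\<^sup>2 / 2 + (- (of_real y)\<^sup>2 / 2 + \<i> * (v * y)) = c * (a + 1 * y) - (a + 1 * y)\<^sup>2 / 2"
      unfolding c by (simp add: power2_eq_square field_simps)
    finally show ?thesis by simp
  qed
  have val: "exp (c * a - a\<^sup>2 / 2) * sqrt (2 * pi) * exp (- v\<^sup>2 / 2) = sqrt (2 * pi) * exp (c\<^sup>2 / 2)"
  proof -
    have "exp (c * a - a\<^sup>2 / 2) * exp (- v\<^sup>2 / 2) = exp ((c * a - a\<^sup>2 / 2) + (- v\<^sup>2 / 2))"
      by (simp only: exp_add exp_of_real[symmetric])
    also have "(c * a - a\<^sup>2 / 2) + (- v\<^sup>2 / 2) = c\<^sup>2 / 2"
      unfolding c by (simp add: power2_eq_square field_simps)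
    finally show ?thesis by (simp add: ac_simps)
  qed
  show ?thesis
    using * unfolding eq val
    by (subst lborel_has_bochner_integral_real_affine_iff[of 1 _ _ a]) simp_all
qed

text \<open>Products of Hermite polynomials with $e^{cy - y^2/2}$ have this growth, so that integrability and the vanishing of boundary terms
come from one place.\<close>

lemma gaussian_dominated:
  fixes f :: "real \<Rightarrow> complex"
  assumes [measurable]: "f \<in> borel_measurable borel"
    and bound: "\<And>y. norm (f y) \<le> C * exp (N * \<bar>y\<bar> + a * y - y\<^sup>2 / 2)"
  shows "integrable lborel f" "(f \<longlongrightarrow> 0) at_top" "(f \<longlongrightarrow> 0) at_bot"
proof -
  have C: "C \<ge> 0"
    using order_trans[OF norm_ge_zero bound[of 0]] by simp
  have int: "integrable lborel (\<lambda>y. exp (b * y - y\<^sup>2 / 2))" for b :: real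
    using integrable_norm[OF has_bochner_integral_iff[THEN iffD1, THEN conjunct1, OF gaussian_mgf[of "of_real b"]]]
    by (simp add: power2_eq_square)
  show "integrable lborel f"
  proof (rule Bochner_Integration.integrable_bound)
    show "integrable lborel (\<lambda>y. C * (exp ((N + a) * y - y\<^sup>2 / 2) + exp ((a - N) * y - y\<^sup>2 / 2)))"
      by (intro Bochner_Integration.integrable_add integrable_mult_right int)
    have "norm (f y) \<le> C * (exp ((N + a) * y - y\<^sup>2 / 2) + exp ((a - N) * y - y\<^sup>2 / 2))" for y
    proof -
      have "exp (N * \<bar>y\<bar> + a * y - y\<^sup>2 / 2) \<le> exp ((N + a) * y - y\<^sup>2 / 2) + exp ((a - N) * y - y\<^sup>2 / 2)"
        by (cases "y \<ge> 0") (auto simp: algebra_simps)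
      then show ?thesis
        using bound[of y] C by (meson mult_left_mono order_trans)
    qed
    then show "AE y in lborel. norm (f y) \<le> norm (C * (exp ((N + a) * y - y\<^sup>2 / 2) + exp ((a - N) * y - y\<^sup>2 / 2)))"
      using C by (auto simp: abs_mult intro!: AE_I2 order_trans[OF _ abs_ge_self])
  qed simp
  show "(f \<longlongrightarrow> 0) at_top"
  proof (rule Lim_null_comparison)
    show "((\<lambda>y. C * exp (N * y + a * y - y\<^sup>2 / 2)) \<longlongrightarrow> 0) at_top"
      by real_asymp
    show "\<forall>\<^sub>F y in at_top. norm (f y) \<le> C * exp (N * y + a * y - y\<^sup>2 / 2)"
      using eventually_ge_at_top[of 0] by eventually_elim (metis bound abs_of_nonneg)
  qed
  show "(f \<longlongrightarrow> 0) at_bot"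
  proof (rule Lim_null_comparison)
    show "((\<lambda>y. C * exp (N * (-y) + a * y - y\<^sup>2 / 2)) \<longlongrightarrow> 0) at_bot"
      by real_asymp
    show "\<forall>\<^sub>F y in at_bot. norm (f y) \<le> C * exp (N * (-y) + a * y - y\<^sup>2 / 2)"
      using eventually_le_at_bot[of 0] by eventually_elim (metis bound abs_of_nonpos)
  qed
qed

lemma integral_deriv_eq_0:
  fixes F f :: "real \<Rightarrow> complex"
  assumes deriv: "\<And>y. (F has_vector_derivative f y) (at y)"
    and cont: "continuous_on UNIV f" and int: "integrable lborel f"
    and lim: "(F \<longlongrightarrow> 0) at_top" "(F \<longlongrightarrow> 0) at_bot"
  shows "(LINT y|lborel. f y) = 0"
proof -
  have "(LBINT y=-\<infinity>..\<infinity>. f y) = 0 - 0"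
  proof (rule interval_integral_FTC_integrable[where F = F])
    show "((F \<circ> real_of_ereal) \<longlongrightarrow> 0) (at_left \<infinity>)" "((F \<circ> real_of_ereal) \<longlongrightarrow> 0) (at_right (- \<infinity>))"
      using lim by (simp_all add: ereal_tendsto_simps)
    show "set_integrable lborel (einterval (- \<infinity>) \<infinity>) f"
      using int by (simp add: set_integrable_def)
  qed (use deriv cont in \<open>auto simp: continuous_on_eq_continuous_at\<close>)
  then show ?thesis
    by (simp add: interval_lebesgue_integral_def set_lebesgue_integral_def)
qed

text \<open>The inner product of a Hermite function with a shifted and modulated one is such an integral, up to
a factor: $b$ is the shift, and $c$ collects shift and modulation.\<close>

definition hermite_moment :: "nat \<Rightarrow> nat \<Rightarrow> complex \<Rightarrow> complex \<Rightarrow> complex" where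
  "hermite_moment m n b c =
     (LINT y|lborel. hermite_poly m (of_real y) * hermite_poly n (of_real y + b) * exp (c * of_real y - (of_real y)\<^sup>2 / 2))"

lemma hermite_product_dominated:
  fixes b c :: complex
  obtains C where "\<And>y::real. norm (hermite_poly m (of_real y) * hermite_poly n (of_real y + b) *
      exp (c * of_real y - (of_real y)\<^sup>2 / 2)) \<le> C * exp (real (m + n) * \<bar>y\<bar> + Re c * y - y\<^sup>2 / 2)"
proof -
  obtain C D where C: "C \<ge> 0" "\<And>y::real. norm (hermite_poly m (of_real y + 0 :: complex)) \<le> C * exp (real m * \<bar>y\<bar>)"
    and D: "D \<ge> 0" "\<And>y::real. norm (hermite_poly n (of_real y + b)) \<le> D * exp (real n * \<bar>y\<bar>)"
    using hermite_poly_bound[of m 0] hermite_poly_bound[of n b] by blast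
  show thesis
  proof (rule that[of "C * D"])
    fix y :: real
    have "norm (exp (c * of_real y - (of_real y)\<^sup>2 / 2)) = exp (Re c * y - y\<^sup>2 / 2)"
      by (simp add: power2_eq_square)
    moreover have "norm (hermite_poly m (of_real y :: complex)) * norm (hermite_poly n (of_real y + b)) \<le>
        (C * exp (real m * \<bar>y\<bar>)) * (D * exp (real n * \<bar>y\<bar>))"
      by (intro mult_mono) (use C D in auto)
    ultimately have "norm (hermite_poly m (of_real y) * hermite_poly n (of_real y + b) *
      exp (c * of_real y - (of_real y)\<^sup>2 / 2)) \<le> (C * exp (real m * \<bar>y\<bar>)) * (D * exp (real n * \<bar>y\<bar>)) * exp (Re c * y - y\<^sup>2 / 2)"
      unfolding norm_mult by (metis exp_ge_zero mult_right_mono)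
    also have "\<dots> = C * D * exp (real (m + n) * \<bar>y\<bar> + Re c * y - y\<^sup>2 / 2)"
      by (simp add: exp_add[symmetric] algebra_simps exp_diff)
    finally show "norm (hermite_poly m (of_real y) * hermite_poly n (of_real y + b) *
      exp (c * of_real y - (of_real y)\<^sup>2 / 2)) \<le> C * D * exp (real (m + n) * \<bar>y\<bar> + Re c * y - y\<^sup>2 / 2)" .
  qed
qed

lemma hermite_product_gaussian:
  fixes m n :: nat and b c :: complex
  defines "f \<equiv> (\<lambda>y::real. hermite_poly m (of_real y) * hermite_poly n (of_real y + b) * exp (c * of_real y - (of_real y)\<^sup>2 / 2))"
  shows "continuous_on UNIV f" "integrable lborel f" "(f \<longlongrightarrow> 0) at_top" "(f \<longlongrightarrow> 0) at_bot"
proof -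
  show "continuous_on UNIV f" unfolding f_def by (intro continuous_intros) auto
  then have "f \<in> borel_measurable borel" by (rule borel_measurable_continuous_onI)
  moreover obtain C where "\<And>y. norm (f y) \<le> C * exp (real (m + n) * \<bar>y\<bar> + Re c * y - y\<^sup>2 / 2)"
    unfolding f_def by (rule hermite_product_dominated) blast
  ultimately show "integrable lborel f" "(f \<longlongrightarrow> 0) at_top" "(f \<longlongrightarrow> 0) at_bot"
    by (blast intro: gaussian_dominated)+
qed

text \<open>Integration by parts: $H_{m+1}(y)\,e^{-y^2/2}$ is the derivative of $-H_m(y)\,e^{-y^2/2}$, and
the derivative of $H_n(y+b)\,e^{cy}$ is $n H_{n-1}(y+b)\,e^{cy} + c\,H_n(y+b)\,e^{cy}$.\<close>

lemma hermite_moment_Suc: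
  "hermite_moment (Suc m) n b c = of_nat n * hermite_moment m (n - 1) b c + c * hermite_moment m n b c"
proof -
  define f where "f = (\<lambda>m n (y::real). hermite_poly m (of_real y) * hermite_poly n (of_real y + b) * exp (c * of_real y - (of_real y)\<^sup>2 / 2))"
  have deriv: "(f m n has_vector_derivative of_nat n * f m (n - 1) y + c * f m n y - f (Suc m) n y) (at y)" for y
  proof -
    have "((\<lambda>y. hermite_poly m y * hermite_poly n (y + b) * exp (c * y - y\<^sup>2 / 2)) has_field_derivative
        of_nat n * f m (n - 1) y + c * f m n y - f (Suc m) n y) (at (of_real y))"
      unfolding f_def
      by (rule derivative_eq_intros refl | simp)+
        (simp add: hermite_poly_Suc[of m] algebra_simps power2_eq_square)
    then show ?thesis
      unfolding f_def using has_vector_derivative_real_field by blast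
  qed
  have int: "integrable lborel (f m n)" for m n
    unfolding f_def by (rule hermite_product_gaussian)
  have "(LINT y|lborel. of_nat n * f m (n - 1) y + c * f m n y - f (Suc m) n y) = 0"
  proof (rule integral_deriv_eq_0[OF deriv])
    have "continuous_on UNIV (f m n)" for m n
      unfolding f_def by (rule hermite_product_gaussian)
    then show "continuous_on UNIV (\<lambda>y. of_nat n * f m (n - 1) y + c * f m n y - f (Suc m) n y)"
      by (intro continuous_intros)
  qed (use int in \<open>auto simp: f_def hermite_product_gaussian\<close>)
  then show ?thesis
    using int by (simp add: hermite_moment_def f_def)
qed

lemma hermite_moment_0_right:
  fixes b c :: complex
  shows "hermite_moment m 0 b c = sqrt (2 * pi) * exp (c\<^sup>2 / 2) * c ^ m"
proof (induction m)
  case 0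
  show ?case
    using gaussian_mgf[of "c"] unfolding has_bochner_integral_iff by (simp add: hermite_moment_def)
qed (simp add: hermite_moment_Suc)

lemma hermite_moment_0_left:
  fixes b c :: complex
  shows "hermite_moment 0 n b c = sqrt (2 * pi) * exp (c\<^sup>2 / 2) * (b + c) ^ n"
proof -
  have int: "integrable lborel (\<lambda>y::real. hermite_poly m (of_real y) * exp (c * of_real y - (of_real y)\<^sup>2 / 2))" for m
    using hermite_product_gaussian(2)[of m 0 0 c] by simp
  have "hermite_moment 0 n b c = (LINT y|lborel. (\<Sum>k\<le>n. (of_nat (n choose k) * b ^ k) *
      (hermite_poly (n - k) (of_real y) * exp (c * of_real y - (of_real y)\<^sup>2 / 2))))"
    unfolding hermite_moment_def hermite_poly_add
    by (simp add: sum_distrib_left sum_distrib_right ac_simps)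
  also have "\<dots> = (\<Sum>k\<le>n. (of_nat (n choose k) * b ^ k) * hermite_moment (n - k) 0 0 c)"
    unfolding hermite_moment_def using int by (subst Bochner_Integration.integral_sum) (auto simp: ac_simps)
  also have "\<dots> = sqrt (2 * pi) * exp (c\<^sup>2 / 2) * (\<Sum>k\<le>n. of_nat (n choose k) * b ^ k * c ^ (n - k))"
    unfolding hermite_moment_0_right by (simp add: sum_distrib_left ac_simps)
  finally show ?thesis by (simp add: binomial_ring)
qed

text \<open>The terms of the sum are those of the Leibniz rule for the $m$-th derivative of
$H_n(y+b)\,e^{cy}$; Pascal's rule matches the recursion in $m$.\<close>

lemma hermite_moment_eq:
  fixes b c :: complex
  shows "hermite_moment m n b c = sqrt (2 * pi) * exp (c\<^sup>2 / 2) *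
     (\<Sum>k\<le>m. of_nat ((m choose k) * (n choose k) * fact k) * c ^ (m - k) * (b + c) ^ (n - k))"
proof (induction m arbitrary: n)
  case 0
  show ?case by (simp add: hermite_moment_0_left)
next
  case (Suc m)
  let ?E = "sqrt (2 * pi) * exp (c\<^sup>2 / 2) :: complex"
  let ?t = "\<lambda>m n k. of_nat ((m choose k) * (n choose k) * fact k) * c ^ (m - k) * (b + c) ^ (n - k) :: complex"
  have shift: "of_nat n * ?t m (n - 1) k = of_nat ((m choose k) * (n choose Suc k) * fact (Suc k)) * c ^ (m - k) * (b + c) ^ (n - Suc k)" for k
  proof (cases n)
    case (Suc l)
    have "n * ((m choose k) * (l choose k) * fact k) = (m choose k) * fact k * (Suc l * (l choose k))"
      unfolding Suc by (simp only: ac_simps)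
    also have "\<dots> = (m choose k) * (n choose Suc k) * fact (Suc k)"
      unfolding Suc_times_binomial[symmetric] Suc fact_Suc of_nat_id by (simp only: ac_simps)
    finally have "n * ((m choose k) * (l choose k) * fact k) = (m choose k) * (n choose Suc k) * fact (Suc k)" .
    then have "of_nat n * of_nat ((m choose k) * (l choose k) * fact k) = (of_nat ((m choose k) * (n choose Suc k) * fact (Suc k)) :: complex)"
      by (metis of_nat_mult)
    moreover have "n - 1 = l" using Suc by simp
    ultimately show ?thesis
      by (simp only: mult.assoc[symmetric]) (simp add: Suc)
  qed simp
  have "hermite_moment (Suc m) n b c = ?E * (\<Sum>k\<le>m. of_nat n * ?t m (n - 1) k) + ?E * (\<Sum>k\<le>m. c * ?t m n k)"
    unfolding hermite_moment_Suc Suc.IH by (simp add: sum_distrib_left ac_simps)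
  also have "(\<Sum>k\<le>m. c * ?t m n k) = (\<Sum>k\<le>m. of_nat ((m choose k) * (n choose k) * fact k) * c ^ (Suc m - k) * (b + c) ^ (n - k))"
    by (rule sum.cong) (auto simp: Suc_diff_le)
  also have "\<dots> = (\<Sum>k\<le>Suc m. of_nat ((m choose k) * (n choose k) * fact k) * c ^ (Suc m - k) * (b + c) ^ (n - k))"
    by simp
  also have "\<dots> = c ^ Suc m * (b + c) ^ n + (\<Sum>k\<le>m. of_nat ((m choose Suc k) * (n choose Suc k) * fact (Suc k)) * c ^ (m - k) * (b + c) ^ (n - Suc k))"
    unfolding sum.atMost_Suc_shift by simp
  also have "?E * (\<Sum>k\<le>m. of_nat n * ?t m (n - 1) k) +
      ?E * (c ^ Suc m * (b + c) ^ n + (\<Sum>k\<le>m. of_nat ((m choose Suc k) * (n choose Suc k) * fact (Suc k)) * c ^ (m - k) * (b + c) ^ (n - Suc k)))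
     = ?E * (c ^ Suc m * (b + c) ^ n + (\<Sum>k\<le>m. ?t (Suc m) n (Suc k)))"
  proof -
    have pascal: "?t (Suc m) n (Suc k) =
        of_nat ((m choose k) * (n choose Suc k) * fact (Suc k)) * c ^ (m - k) * (b + c) ^ (n - Suc k) +
        of_nat ((m choose Suc k) * (n choose Suc k) * fact (Suc k)) * c ^ (m - k) * (b + c) ^ (n - Suc k)" for k
      by (simp only: binomial_Suc_Suc of_nat_mult of_nat_add diff_Suc_Suc distrib_right)
    show ?thesis
      unfolding shift pascal sum.distrib distrib_left by (simp only: ac_simps)
  qed
  also have "\<dots> = ?E * (\<Sum>k\<le>Suc m. ?t (Suc m) n k)"
    unfolding sum.atMost_Suc_shift by simp
  finally show ?case .
qed

text \<open>For $m = n$ the powers of $c$ and $b+c$ pair up, so that only the product $c(b+c)$ enters. It is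
minus a squared modulus for Hermite functions, and the sum becomes a Laguerre polynomial.\<close>

lemma hermite_moment_diagonal:
  fixes b c :: complex
  assumes "c * (b + c) = - of_real q"
  shows "hermite_moment r r b c = sqrt (2 * pi) * exp (c\<^sup>2 / 2) * fact r * laguerre r q"
proof -
  have "(\<Sum>k\<le>r. of_nat ((r choose k) * (r choose k) * fact k) * c ^ (r - k) * (b + c) ^ (r - k)) =
      (\<Sum>k\<le>r. of_nat ((r choose k) * (r choose k) * fact k) * (- of_real q) ^ (r - k))"
    by (simp add: mult.assoc power_mult_distrib[symmetric] assms)
  also have "\<dots> = (\<Sum>k\<le>r. of_nat ((r choose k) * (r choose k) * fact (r - k)) * (- of_real q) ^ k)"
    by (rule sum.reindex_bij_witness[of _ "\<lambda>k. r - k" "\<lambda>k. r - k"]) (auto simp: binomial_symmetric[symmetric])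
  also have "\<dots> = (\<Sum>k\<le>r. fact r * ((- 1) ^ k * of_nat (r choose k) * of_real q ^ k / fact k))"
  proof (rule sum.cong)
    fix k assume "k \<in> {..r}"
    then have "fact k * fact (r - k) * (r choose k) = (fact r :: nat)"
      by (simp add: binomial_fact_lemma)
    then have "fact r = (fact k * fact (r - k) * of_nat (r choose k) :: complex)"
      by (metis of_nat_fact of_nat_mult)
    then show "of_nat ((r choose k) * (r choose k) * fact (r - k)) * (- of_real q) ^ k =
        fact r * ((- 1) ^ k * of_nat (r choose k) * of_real q ^ k / fact k :: complex)"
      by (simp add: power_minus[of "of_real q"])
  qed simp
  also have "\<dots> = fact r * laguerre r q"
    by (simp add: laguerre_def sum_distrib_left)
  finally show ?thesis
    unfolding hermite_moment_eq by simp
qed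

section \<open>Circle means of the generating function\<close>

text \<open>The derivatives in $w$ of the generating function $e^{yw - w^2/2} = \sum_n H_n(y) w^n/n!$ of the
Hermite polynomials, in closed form.\<close>

definition hermite_exp :: "nat \<Rightarrow> complex \<Rightarrow> complex \<Rightarrow> complex" where
  "hermite_exp m y w = exp (y * w - w\<^sup>2 / 2) * hermite_poly m (y - w)"

lemma hermite_exp_deriv: "(hermite_exp m y has_field_derivative hermite_exp (Suc m) y w) (at w)"
  unfolding hermite_exp_def
  by (rule derivative_eq_intros refl | simp)+
    (simp add: hermite_poly_Suc[of m] algebra_simps power2_eq_square)

lemma hermite_exp_higher_deriv:
  "(deriv ^^ k) (\<lambda>v. hermite_exp m y (a * v)) v = a ^ k * hermite_exp (m + k) y (a * v)"
proof (induction k arbitrary: v)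
  case (Suc k)
  have "((\<lambda>v. a ^ k * hermite_exp (m + k) y (a * v)) has_field_derivative
      a ^ k * (hermite_exp (Suc (m + k)) y (a * v) * a)) (at v)"
    by (auto intro!: derivative_eq_intros DERIV_chain2[OF hermite_exp_deriv])
  moreover have "(deriv ^^ k) (\<lambda>v. hermite_exp m y (a * v)) = (\<lambda>v. a ^ k * hermite_exp (m + k) y (a * v))"
    using Suc by blast
  ultimately show ?case
    by (simp add: DERIV_imp_deriv ac_simps)
qed simp

text \<open>Cauchy's formula on the unit circle, read as a statement on Fourier coefficients.\<close>

lemma circle_fourier_coefficient:
  assumes "f holomorphic_on UNIV"
  shows "((\<lambda>s::real. f (exp (2 * pi * \<i> * s)) / exp (2 * pi * \<i> * s) ^ k) has_integral (deriv ^^ k) f 0 / fact k) {0..1}"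
proof -
  have "((\<lambda>u. f u / (u - 0) ^ Suc k) has_contour_integral (2 * pi * \<i> / fact k * (deriv ^^ k) f 0)) (circlepath 0 1)"
    using assms by (intro Cauchy_has_contour_integral_higher_derivative_circlepath)
      (auto intro: holomorphic_on_imp_continuous_on holomorphic_on_subset)
  then have "((\<lambda>s. f (circlepath 0 1 s) / circlepath 0 1 s ^ Suc k *
      vector_derivative (circlepath 0 1) (at s within {0..1})) has_integral
      (2 * pi * \<i> / fact k * (deriv ^^ k) f 0)) {0..1}"
    by (simp add: has_contour_integral_def)
  then have "((\<lambda>s. (1 / (2 * pi * \<i>)) * (f (circlepath 0 1 s) / circlepath 0 1 s ^ Suc k *
      vector_derivative (circlepath 0 1) (at s within {0..1}))) has_integral
      (1 / (2 * pi * \<i>)) * (2 * pi * \<i> / fact k * (deriv ^^ k) f 0)) {0..1}"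
    by (rule has_integral_mult_right)
  then show ?thesis
  proof (rule has_integral_eq_rhs[OF has_integral_eq, rotated])
    fix s :: real assume "s \<in> {0..1}"
    then show "(1 / (2 * pi * \<i>)) * (f (circlepath 0 1 s) / circlepath 0 1 s ^ Suc k *
      vector_derivative (circlepath 0 1) (at s within {0..1})) = f (exp (2 * pi * \<i> * s)) / exp (2 * pi * \<i> * s) ^ k"
      by (simp add: vector_derivative_circlepath01) (simp add: circlepath field_simps)
  qed simp
qed

text \<open>This is the reason why $h_r$ is an eigenfunction of every radial average of time-frequency shifts.
Expanding $H_r(y - w - \overline{w})$ at $y - w$ writes the integrand as a sum of terms
$(-\overline{w})^k\,G_k(w)$ with an entire function $G_k$, the derivative of order $r-k$ of the
generating function $e^{yw - w^2/2}$. On a circle $\overline{w} = |w|^2/w$, so the mean picks the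
$k$-th Taylor coefficient of $G_k$ at $0$. That is $H_r(y)/k!$ for every $k$: all dependence on $y$
factors out, and the remaining sum over $k$ is the Laguerre polynomial at $|w|^2$.\<close>

lemma circle_mean_hermite:
  fixes a y :: complex
  shows "((\<lambda>s::real. let w = a * exp (2 * pi * \<i> * s) in exp (y * w - w\<^sup>2 / 2) * hermite_poly r (y - w - cnj w))
     has_integral laguerre r ((cmod a)\<^sup>2) * hermite_poly r y) {0..1}"
proof -
  let ?e = "\<lambda>s::real. exp (2 * pi * \<i> * s)"
  have summand: "((\<lambda>s. (of_nat (r choose k) * (- cnj a) ^ k) * (hermite_exp (r - k) y (a * ?e s) / ?e s ^ k)) has_integral
      (of_nat (r choose k) * (- cnj a) ^ k) * (a ^ k * hermite_poly r y / fact k)) {0..1}" if "k \<le> r" for k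
  proof (rule has_integral_mult_right)
    have "(\<lambda>v. hermite_exp (r - k) y (a * v)) holomorphic_on UNIV"
      by (rule holomorphic_onI)
        (auto simp: field_differentiable_def intro!: exI derivative_eq_intros DERIV_chain2[OF hermite_exp_deriv])
    from circle_fourier_coefficient[OF this, of k]
    show "((\<lambda>s. hermite_exp (r - k) y (a * ?e s) / ?e s ^ k) has_integral a ^ k * hermite_poly r y / fact k) {0..1}"
      using that by (simp add: hermite_exp_higher_deriv) (simp add: hermite_exp_def)
  qed
  have "((\<lambda>s. \<Sum>k\<le>r. (of_nat (r choose k) * (- cnj a) ^ k) * (hermite_exp (r - k) y (a * ?e s) / ?e s ^ k)) has_integral
      (\<Sum>k\<le>r. (of_nat (r choose k) * (- cnj a) ^ k) * (a ^ k * hermite_poly r y / fact k))) {0..1}"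
    by (rule has_integral_sum) (use summand in auto)
  moreover have "(\<Sum>k\<le>r. (of_nat (r choose k) * (- cnj a) ^ k) * (hermite_exp (r - k) y (a * ?e s) / ?e s ^ k)) =
      (let w = a * ?e s in exp (y * w - w\<^sup>2 / 2) * hermite_poly r (y - w - cnj w))" for s
  proof -
    define w where "w = a * ?e s"
    have "cnj (?e s) = inverse (?e s)"
      by (simp add: exp_cnj exp_minus[symmetric])
    then have "- cnj w = - cnj a / ?e s"
      by (simp add: w_def divide_inverse)
    then have "(- cnj a) ^ k / ?e s ^ k = (- cnj w) ^ k" for k
      by (simp only: power_divide)
    then have "(of_nat (r choose k) * (- cnj a) ^ k) * (hermite_exp (r - k) y w / ?e s ^ k) =
        exp (y * w - w\<^sup>2 / 2) * (of_nat (r choose k) * (- cnj w) ^ k * hermite_poly (r - k) (y - w))" for k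
      by (simp add: hermite_exp_def field_simps)
    then have "(\<Sum>k\<le>r. (of_nat (r choose k) * (- cnj a) ^ k) * (hermite_exp (r - k) y w / ?e s ^ k)) =
        exp (y * w - w\<^sup>2 / 2) * hermite_poly r (y - w + - cnj w)"
      unfolding hermite_poly_add[of r "y - w" "- cnj w"] by (simp only: sum_distrib_left)
    then show ?thesis
      by (simp add: Let_def w_def)
  qed
  moreover have "(\<Sum>k\<le>r. (of_nat (r choose k) * (- cnj a) ^ k) * (a ^ k * hermite_poly r y / fact k)) =
      laguerre r ((cmod a)\<^sup>2) * hermite_poly r y"
  proof -
    have "a ^ k * (- cnj a) ^ k = (- 1) ^ k * of_real (((cmod a)\<^sup>2) ^ k)" for k
    proof -
      have "a ^ k * (- cnj a) ^ k = (- 1 * (a * cnj a)) ^ k"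
        by (simp add: power_mult_distrib[symmetric] mult.commute)
      also have "\<dots> = (- 1) ^ k * (a * cnj a) ^ k"
        by (rule power_mult_distrib)
      finally have "a ^ k * (- cnj a) ^ k = (- 1) ^ k * (a * cnj a) ^ k" .
      then show ?thesis by (simp add: complex_norm_square[symmetric])
    qed
    then have "(of_nat (r choose k) * (- cnj a) ^ k) * (a ^ k * hermite_poly r y / fact k) =
      of_real ((- 1) ^ k * real (r choose k) * ((cmod a)\<^sup>2) ^ k / fact k) * hermite_poly r y" for k
      by (simp only: of_real_mult of_real_divide of_real_power times_divide_eq_left times_divide_eq_right
          mult.assoc mult.left_commute) simp
    then show ?thesis
      unfolding laguerre_def of_real_sum sum_distrib_right by (rule sum.cong[OF refl])
  qed
  ultimately show ?thesis by simp
qed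

section \<open>Rotations and radial integrals in the plane\<close>

lemma borel_measurable_lborel_pair_continuousI:
  fixes f :: "'a::euclidean_space \<times> 'b::euclidean_space \<Rightarrow> 'c::topological_space"
  assumes "continuous_on UNIV f"
  shows "f \<in> borel_measurable (lborel \<Otimes>\<^sub>M lborel)"
  using borel_measurable_continuous_onI[OF assms] by (simp add: lborel_prod)

text \<open>Rotations preserve area because they are products of shears, and a shear acts by a translation on
each line parallel to an axis.\<close>

lemma lborel_shear_fst: "distr lborel borel (\<lambda>p. (fst p + a * snd p, snd p)) = (lborel :: (real \<times> real) measure)"
proof (rule measure_eqI)
  fix A :: "(real \<times> real) set"
  assume "A \<in> sets (distr lborel borel (\<lambda>p. (fst p + a * snd p, snd p)))"
  then have [measurable]: "A \<in> sets borel" by simp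
  have A' [measurable]: "A \<in> sets (borel \<Otimes>\<^sub>M borel)" unfolding borel_prod by fact
  have [measurable]: "(\<lambda>p::real \<times> real. (fst p + a * snd p, snd p)) \<in> borel_measurable borel"
    by (intro borel_measurable_continuous_onI continuous_intros)
  have "emeasure (distr lborel borel (\<lambda>p. (fst p + a * snd p, snd p))) A
      = (\<integral>\<^sup>+p. indicator A (fst p + a * snd p, snd p) \<partial>(lborel \<Otimes>\<^sub>M lborel))"
    by (subst nn_integral_indicator[symmetric], simp, subst nn_integral_distr) (auto simp: lborel_prod)
  also have "\<dots> = (\<integral>\<^sup>+y. \<integral>\<^sup>+x. indicator A (y * a + 1 * x, y) \<partial>lborel \<partial>lborel)"
    by (subst lborel_pair.nn_integral_snd[symmetric]) (auto simp: ac_simps)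
  also have "\<dots> = (\<integral>\<^sup>+y. \<integral>\<^sup>+x. indicator A (x, y) \<partial>lborel \<partial>lborel)"
  proof (rule nn_integral_cong)
    fix y show "(\<integral>\<^sup>+x. indicator A (y * a + 1 * x, y) \<partial>lborel) = (\<integral>\<^sup>+x. indicator A (x, y) \<partial>lborel)"
      by (subst nn_integral_real_affine[of "\<lambda>x. indicator A (x, y)" 1 "y * a"]) auto
  qed
  also have "\<dots> = (\<integral>\<^sup>+p. indicator A p \<partial>(lborel \<Otimes>\<^sub>M lborel))"
    by (subst lborel_pair.nn_integral_snd) auto
  finally show "emeasure (distr lborel borel (\<lambda>p. (fst p + a * snd p, snd p))) A = emeasure lborel A"
    by (simp add: lborel_prod)
qed simp

lemma lborel_shear_snd: "distr lborel borel (\<lambda>p. (fst p, snd p + a * fst p)) = (lborel :: (real \<times> real) measure)"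
proof (rule measure_eqI)
  fix A :: "(real \<times> real) set"
  assume "A \<in> sets (distr lborel borel (\<lambda>p. (fst p, snd p + a * fst p)))"
  then have [measurable]: "A \<in> sets borel" by simp
  have A' [measurable]: "A \<in> sets (borel \<Otimes>\<^sub>M borel)" unfolding borel_prod by fact
  have [measurable]: "(\<lambda>p::real \<times> real. (fst p, snd p + a * fst p)) \<in> borel_measurable borel"
    by (intro borel_measurable_continuous_onI continuous_intros)
  have "emeasure (distr lborel borel (\<lambda>p. (fst p, snd p + a * fst p))) A
      = (\<integral>\<^sup>+p. indicator A (fst p, snd p + a * fst p) \<partial>(lborel \<Otimes>\<^sub>M lborel))"
    by (subst nn_integral_indicator[symmetric], simp, subst nn_integral_distr) (auto simp: lborel_prod)
  also have "\<dots> = (\<integral>\<^sup>+x. \<integral>\<^sup>+y. indicator A (x, x * a + 1 * y) \<partial>lborel \<partial>lborel)"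
    by (subst lborel.nn_integral_fst[symmetric]) (auto simp: ac_simps)
  also have "\<dots> = (\<integral>\<^sup>+x. \<integral>\<^sup>+y. indicator A (x, y) \<partial>lborel \<partial>lborel)"
  proof (rule nn_integral_cong)
    fix x show "(\<integral>\<^sup>+y. indicator A (x, x * a + 1 * y) \<partial>lborel) = (\<integral>\<^sup>+y. indicator A (x, y) \<partial>lborel)"
      by (subst nn_integral_real_affine[of "\<lambda>y. indicator A (x, y)" 1 "x * a"]) auto
  qed
  also have "\<dots> = (\<integral>\<^sup>+p. indicator A p \<partial>(lborel \<Otimes>\<^sub>M lborel))"
    by (subst lborel.nn_integral_fst) auto
  finally show "emeasure (distr lborel borel (\<lambda>p. (fst p, snd p + a * fst p))) A = emeasure lborel A"
    by (simp add: lborel_prod)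
qed simp

definition rotate_plane :: "real \<Rightarrow> real \<times> real \<Rightarrow> real \<times> real" where
  "rotate_plane \<theta> p = (cos \<theta> * fst p - sin \<theta> * snd p, sin \<theta> * fst p + cos \<theta> * snd p)"

lemma rotate_plane_add: "rotate_plane (\<alpha> + \<beta>) p = rotate_plane \<alpha> (rotate_plane \<beta> p)"
  by (simp add: rotate_plane_def sin_add cos_add algebra_simps)

lemma measurable_rotate_plane [measurable]: "rotate_plane \<theta> \<in> borel_measurable borel"
  unfolding rotate_plane_def by (intro borel_measurable_continuous_onI continuous_intros)

lemma norm_rotate_plane: "norm (rotate_plane \<theta> p) = norm p"
proof -
  have "(cos \<theta> * x - sin \<theta> * y)\<^sup>2 + (sin \<theta> * x + cos \<theta> * y)\<^sup>2 = ((cos \<theta>)\<^sup>2 + (sin \<theta>)\<^sup>2) * (x\<^sup>2 + y\<^sup>2)" for x y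
    by algebra
  then show ?thesis by (simp add: rotate_plane_def norm_prod_def)
qed

lemma lborel_rotate_plane: "distr lborel borel (rotate_plane \<theta>) = lborel"
proof -
  have regular: "distr lborel borel (rotate_plane \<theta>) = lborel" if "sin \<theta> \<noteq> 0" for \<theta>
  proof -
    \<comment> \<open>with $a = -\tan(\theta/2)$, the rotation is the shear by $a$ along the first axis, the one by $\sin\theta$ along the second, then again the one by $a$\<close>
    define a where "a = (cos \<theta> - 1) / sin \<theta>"
    have a: "a * sin \<theta> = cos \<theta> - 1" "a + a * cos \<theta> = - sin \<theta>"
    proof -
      show as: "a * sin \<theta> = cos \<theta> - 1" using that by (simp add: a_def)
      have "(a + a * cos \<theta>) * sin \<theta> = (a * sin \<theta>) * (1 + cos \<theta>)"
        by (simp add: algebra_simps)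
      also have "\<dots> = - sin \<theta> * sin \<theta>"
        unfolding as using sin_cos_squared_add[of \<theta>] by algebra
      finally have "(a + a * cos \<theta>) * sin \<theta> = - sin \<theta> * sin \<theta>" .
      then show "a + a * cos \<theta> = - sin \<theta>" using that mult_right_cancel by blast
    qed
    let ?S = "\<lambda>p::real \<times> real. (fst p + a * snd p, snd p)" and ?T = "\<lambda>p::real \<times> real. (fst p, snd p + sin \<theta> * fst p)"
    have "rotate_plane \<theta> = ?S \<circ> (?T \<circ> ?S)"
    proof
      fix p :: "real \<times> real"
      have "fst p + a * snd p + a * (snd p + sin \<theta> * (fst p + a * snd p)) =
         fst p + (a * sin \<theta>) * fst p + (a + a * (a * sin \<theta>) + a) * snd p"
        by (simp add: algebra_simps)
      also have "\<dots> = cos \<theta> * fst p + (a + a * cos \<theta>) * snd p"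
        unfolding a(1) by (simp add: algebra_simps)
      finally have 1: "fst p + a * snd p + a * (snd p + sin \<theta> * (fst p + a * snd p)) = cos \<theta> * fst p - sin \<theta> * snd p"
        unfolding a(2) by simp
      have "snd p + sin \<theta> * (fst p + a * snd p) = sin \<theta> * fst p + (1 + a * sin \<theta>) * snd p"
        by (simp add: algebra_simps)
      then have 2: "snd p + sin \<theta> * (fst p + a * snd p) = sin \<theta> * fst p + cos \<theta> * snd p"
        unfolding a(1) by simp
      show "rotate_plane \<theta> p = (?S \<circ> (?T \<circ> ?S)) p"
        using 1 2 by (simp add: rotate_plane_def)
    qed
    moreover have S: "?S \<in> borel_measurable borel" and T: "?T \<in> borel_measurable borel"
      by (intro borel_measurable_continuous_onI continuous_intros)+
    ultimately have "distr lborel borel (rotate_plane \<theta>) = distr (distr (distr lborel borel ?S) borel ?T) borel ?S"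
      using measurable_comp[OF S T] by (simp add: distr_distr)
    then show ?thesis by (simp add: lborel_shear_fst lborel_shear_snd)
  qed
  show ?thesis
  proof (cases "sin \<theta> = 0")
    case True
    \<comment> \<open>a multiple of a half turn is split into two rotations whose sines do not vanish\<close>
    have "rotate_plane \<theta> = rotate_plane (\<theta> - pi / 2) \<circ> rotate_plane (pi / 2)"
      using rotate_plane_add[of "\<theta> - pi / 2" "pi / 2"] by (auto simp: fun_eq_iff)
    then have "distr lborel borel (rotate_plane \<theta>) =
        distr (distr lborel borel (rotate_plane (pi / 2))) borel (rotate_plane (\<theta> - pi / 2))"
      by (simp add: distr_distr)
    also have "distr lborel borel (rotate_plane (pi / 2)) = lborel"
      by (rule regular) simp
    also have "distr lborel borel (rotate_plane (\<theta> - pi / 2)) = lborel"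
      using True sin_cos_squared_add[of \<theta>] by (intro regular) (auto simp: sin_diff)
    finally show ?thesis .
  qed (rule regular)
qed

lemma emeasure_disc: "r \<ge> 0 \<Longrightarrow> emeasure lborel (ball (0::real \<times> real) r) = ennreal (pi * r\<^sup>2)"
  "r \<ge> 0 \<Longrightarrow> emeasure lborel (cball (0::real \<times> real) r) = ennreal (pi * r\<^sup>2)"
  by (simp_all add: emeasure_ball emeasure_cball unit_ball_vol_2 power2_eq_square)

text \<open>The area between the circles of squared radius $s/\pi$ and $t/\pi$ is $t - s$, so radial
integrands over a disc reduce to integrands over an interval, without a density.\<close>

lemma distr_disc_area:
  assumes "R > 0"
  shows "distr (density lborel (indicator (ball (0::real \<times> real) R))) borel (\<lambda>u. pi * (norm u)\<^sup>2) =
    density lborel (indicator {0..pi * R\<^sup>2})" (is "?M = ?N")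
proof (rule measure_eqI_lessThan)
  fix x :: real
  have [measurable]: "(\<lambda>u::real \<times> real. pi * (norm u)\<^sup>2) -` {x<..} \<in> sets borel"
    using measurable_sets_borel[of "\<lambda>u::real \<times> real. pi * (norm u)\<^sup>2" borel "{x<..}"] by simp
  have M: "emeasure ?M {x<..} = emeasure lborel (ball 0 R - {u::real \<times> real. pi * (norm u)\<^sup>2 \<le> x})"
    by (subst emeasure_distr, simp, simp, subst emeasure_density, measurable)
      (use \<open>_ -` _ \<in> _\<close> in \<open>auto intro!: nn_integral_cong simp: indicator_def simp flip: nn_integral_indicator\<close>)
  have N: "emeasure ?N {x<..} = emeasure lborel ({0..pi * R\<^sup>2} \<inter> {x<..})"
    by (subst emeasure_density) (auto simp: indicator_inter_arith[symmetric])
  show "emeasure ?M {x<..} = emeasure ?N {x<..}"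
  proof (cases "x < 0")
    case True
    have "\<not> pi * (norm u)\<^sup>2 \<le> x" for u :: "real \<times> real"
    proof -
      have "0 \<le> pi * (norm u)\<^sup>2" by simp
      then show ?thesis using True by linarith
    qed
    then have "{u::real \<times> real. pi * (norm u)\<^sup>2 \<le> x} = {}" by blast
    then have "ball 0 R - {u::real \<times> real. pi * (norm u)\<^sup>2 \<le> x} = ball 0 R"
      by (simp only: Diff_empty)
    moreover have "{0..pi * R\<^sup>2} \<inter> {x<..} = {0..pi * R\<^sup>2}"
      using True by auto
    ultimately show ?thesis unfolding M N using assms by (simp add: emeasure_disc)
  next
    case False
    define \<rho> where "\<rho> = sqrt (x / pi)"
    have \<rho>: "\<rho> \<ge> 0" "pi * \<rho>\<^sup>2 = x" using False by (auto simp: \<rho>_def)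
    have C: "{u::real \<times> real. pi * (norm u)\<^sup>2 \<le> x} = cball 0 \<rho>"
      using \<rho> by (auto simp flip: \<rho>(2) simp: power_mono_iff)
    show ?thesis
    proof (cases "\<rho> < R")
      case True
      have "emeasure lborel (ball (0::real \<times> real) R - cball 0 \<rho>) = ennreal (pi * R\<^sup>2) - ennreal (pi * \<rho>\<^sup>2)"
        using assms \<rho> True
        by (subst emeasure_Diff) (auto simp: emeasure_disc)
      moreover have "{0..pi * R\<^sup>2} \<inter> {x<..} = {x<..pi * R\<^sup>2}" using False by auto
      moreover have "x \<le> pi * R\<^sup>2" using True \<rho> by (auto simp flip: \<rho>(2) intro!: power_mono)
      ultimately show ?thesis unfolding M N C using \<rho> False
        by (simp add: ennreal_minus)
    next
      case False
      have "pi * R\<^sup>2 \<le> x" using False assms by (auto simp flip: \<rho>(2) intro!: power_mono)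
      then have "{0..pi * R\<^sup>2} \<inter> {x<..} = {}" by auto
      moreover have "ball (0::real \<times> real) R - cball 0 \<rho> = {}" using False by auto
      ultimately show ?thesis unfolding M N C by (simp only: emeasure_empty)
    qed
  qed
  have "emeasure ?M {x<..} \<le> emeasure lborel (ball (0::real \<times> real) R)"
    unfolding M by (intro emeasure_mono) auto
  then show "emeasure ?M {x<..} < \<infinity>"
    using emeasure_lborel_ball_finite[of "0::real \<times> real" R] by (simp add: less_top order.strict_trans1)
qed simp_all

lemma integral_radial_disc:
  fixes \<phi> :: "real \<Rightarrow> real"
  assumes "R > 0" and [measurable]: "\<phi> \<in> borel_measurable borel"
  shows "(LINT u|lborel. indicator (ball (0::real \<times> real) R) u * \<phi> (pi * (norm u)\<^sup>2)) =
    (LINT t|lborel. indicator {0..pi * R\<^sup>2} t * \<phi> t)"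
proof -
  have "(LINT u|lborel. indicator (ball (0::real \<times> real) R) u * \<phi> (pi * (norm u)\<^sup>2)) =
     integral\<^sup>L (density lborel (\<lambda>u. ennreal (indicator (ball 0 R) u))) (\<lambda>u::real \<times> real. \<phi> (pi * (norm u)\<^sup>2))"
    by (subst integral_density, measurable) auto
  also have "\<dots> = integral\<^sup>L (distr (density lborel (indicator (ball (0::real \<times> real) R))) borel (\<lambda>u. pi * (norm u)\<^sup>2)) \<phi>"
    by (subst integral_distr) (auto simp: ennreal_indicator)
  also have "\<dots> = integral\<^sup>L (density lborel (\<lambda>u. ennreal (indicator {0..pi * R\<^sup>2} u))) \<phi>"
    unfolding distr_disc_area[OF assms(1)] by (simp add: ennreal_indicator)
  also have "\<dots> = (LINT t|lborel. indicator {0..pi * R\<^sup>2} t * \<phi> t)"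
    by (subst integral_density) auto
  finally show ?thesis .
qed

section \<open>Hermite functions and their ambiguity functions\<close>

text \<open>The factor $(-1/(2\sqrt{\pi}))^r$ in the definition cancels the factor $(-2\sqrt{\pi})^r$
that $r$ differentiations of $e^{-2\pi t^2} = e^{-y^2/2}$ produce, where $y = 2\sqrt{\pi}\,t$.\<close>

lemma hermite_fun_eq:
  "hermite_fun r t = of_real (2 powr (1/4) / sqrt (fact r)) * hermite_poly r (of_real (2 * sqrt pi * t)) * exp (of_real (- pi * t\<^sup>2))"
proof -
  have deriv: "(deriv ^^ r) (\<lambda>s. exp (- 2 * pi * s\<^sup>2)) =
      (\<lambda>t. (- (2 * sqrt pi)) ^ r * (hermite_poly r (2 * sqrt pi * t) * exp (- (2 * sqrt pi * t)\<^sup>2 / 2)))" for r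
  proof (induction r)
    case 0
    show ?case by (simp add: power_mult_distrib mult.assoc)
  next
    case (Suc r)
    have d: "((\<lambda>t. (- (2 * sqrt pi)) ^ r * (hermite_poly r (2 * sqrt pi * t) * exp (- (2 * sqrt pi * t)\<^sup>2 / 2)))
       has_field_derivative (- (2 * sqrt pi)) ^ r * ((- hermite_poly (Suc r) (2 * sqrt pi * t) * exp (- (2 * sqrt pi * t)\<^sup>2 / 2)) * (2 * sqrt pi))) (at t)" for t
      by (intro DERIV_cmult DERIV_chain2[OF hermite_poly_gaussian_deriv]) (auto intro!: derivative_eq_intros)
    have "deriv (\<lambda>t. (- (2 * sqrt pi)) ^ r * (hermite_poly r (2 * sqrt pi * t) * exp (- (2 * sqrt pi * t)\<^sup>2 / 2))) t =
       (- (2 * sqrt pi)) ^ Suc r * (hermite_poly (Suc r) (2 * sqrt pi * t) * exp (- (2 * sqrt pi * t)\<^sup>2 / 2))" for t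
      unfolding DERIV_imp_deriv[OF d] by simp
    then show ?case unfolding funpow.simps o_apply Suc by blast
  qed
  have 1: "(- 1 / (2 * sqrt pi)) ^ r * (- (2 * sqrt pi)) ^ r = 1"
    by (simp add: power_mult_distrib[symmetric] field_simps)
  have 2: "exp (pi * t\<^sup>2) * exp (- (2 * sqrt pi * t)\<^sup>2 / 2) = exp (- pi * t\<^sup>2)"
    by (simp add: exp_add[symmetric] power_mult_distrib)
  have eq: "2 powr (1/4) / sqrt (fact r) * (- 1 / (2 * sqrt pi)) ^ r * exp (pi * t\<^sup>2)
       * (deriv ^^ r) (\<lambda>s. exp (- 2 * pi * s\<^sup>2)) t =
     2 powr (1/4) / sqrt (fact r) * hermite_poly r (2 * sqrt pi * t) * exp (- pi * t\<^sup>2)"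
  proof -
    have "2 powr (1/4) / sqrt (fact r) * (- 1 / (2 * sqrt pi)) ^ r * exp (pi * t\<^sup>2)
       * (deriv ^^ r) (\<lambda>s. exp (- 2 * pi * s\<^sup>2)) t =
     2 powr (1/4) / sqrt (fact r) * ((- 1 / (2 * sqrt pi)) ^ r * (- (2 * sqrt pi)) ^ r) * hermite_poly r (2 * sqrt pi * t)
       * (exp (pi * t\<^sup>2) * exp (- (2 * sqrt pi * t)\<^sup>2 / 2))"
      unfolding deriv by (simp only: ac_simps)
    then show ?thesis unfolding 1 2 by simp
  qed
  show ?thesis
    unfolding hermite_fun_def eq by (simp only: hermite_poly_of_real exp_of_real of_real_mult[symmetric])
qed

lemma hermite_fun_cnj [simp]: "cnj (hermite_fun r t) = hermite_fun r t"
  by (simp add: hermite_fun_def)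

lemma continuous_on_hermite_fun [continuous_intros]:
  fixes f :: "'a::topological_space \<Rightarrow> real"
  assumes "continuous_on A f"
  shows "continuous_on A (\<lambda>x. hermite_fun r (f x))"
  unfolding hermite_fun_eq by (intro continuous_intros assms)

lemma borel_measurable_hermite_fun [measurable]: "hermite_fun r \<in> borel_measurable borel"
  by (intro borel_measurable_continuous_onI continuous_intros)

text \<open>With $y = 2\sqrt{\pi}\,t$ the integrand becomes that of a Hermite moment with
$b = -2\sqrt{\pi}\,x$ and $c = \sqrt{\pi}(x + i\xi)$. Then
$c(b+c) = -\pi(x^2+\xi^2)$, and the value is a phase times a radial function.\<close>

lemma hermite_fun_product_integral:
  fixes x \<xi> :: real
  shows "has_bochner_integral lborel
    (\<lambda>t. exp (2 * pi * \<i> * \<xi> * t) * hermite_fun r (t - x) * hermite_fun r t)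
    (exp (\<i> * (pi * x * \<xi>)) * of_real (laguerre r (pi * (x\<^sup>2 + \<xi>\<^sup>2)) * exp (- (pi * (x\<^sup>2 + \<xi>\<^sup>2)) / 2)))"
proof -
  define c where "c = of_real (sqrt pi) * Complex x \<xi>"
  define b where "b = complex_of_real (- 2 * sqrt pi * x)"
  define k where "k = complex_of_real (sqrt 2 / fact r)"
  define f where "f = (\<lambda>y::real. hermite_poly r (of_real y) * hermite_poly r (of_real y + b) * exp (c * of_real y - (of_real y)\<^sup>2 / 2))"
  have pi2: "of_real (sqrt pi) * of_real (sqrt pi) = complex_of_real pi"
    by (metis of_real_mult real_sqrt_mult_self abs_of_nonneg pi_ge_zero)
  have cb: "c * (b + c) = - of_real (pi * (x\<^sup>2 + \<xi>\<^sup>2))"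
  proof -
    have "c * (b + c) = (of_real (sqrt pi) * of_real (sqrt pi)) * (Complex x \<xi> * (- 2 * x + Complex x \<xi>))"
      by (simp add: c_def b_def algebra_simps)
    also have "Complex x \<xi> * (- 2 * x + Complex x \<xi>) = - of_real (x\<^sup>2 + \<xi>\<^sup>2)"
      by (simp add: complex_eq_iff power2_eq_square algebra_simps)
    finally show ?thesis unfolding pi2 by (simp add: algebra_simps)
  qed
  have int: "has_bochner_integral lborel f (sqrt (2 * pi) * exp (c\<^sup>2 / 2) * fact r * laguerre r (pi * (x\<^sup>2 + \<xi>\<^sup>2)))"
    using hermite_moment_diagonal[OF cb, of r] hermite_product_gaussian(2)[of r r b c]
    unfolding hermite_moment_def f_def has_bochner_integral_iff by blast
  have "has_bochner_integral lborel (\<lambda>t. f (0 + (2 * sqrt pi) * t))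
     ((sqrt (2 * pi) * exp (c\<^sup>2 / 2) * fact r * laguerre r (pi * (x\<^sup>2 + \<xi>\<^sup>2))) /\<^sub>R \<bar>2 * sqrt pi\<bar>)"
    by (subst lborel_has_bochner_integral_real_affine_iff[symmetric]) (use int in auto)
  then have *: "has_bochner_integral lborel (\<lambda>t. (k * exp (of_real (- pi * x\<^sup>2))) * f (0 + (2 * sqrt pi) * t))
     ((k * exp (of_real (- pi * x\<^sup>2))) * ((sqrt (2 * pi) * exp (c\<^sup>2 / 2) * fact r * laguerre r (pi * (x\<^sup>2 + \<xi>\<^sup>2))) /\<^sub>R \<bar>2 * sqrt pi\<bar>))"
    by (rule has_bochner_integral_mult_right)
  have norm2: "(2 powr (1/4) / sqrt (fact r)) * (2 powr (1/4) / sqrt (fact r)) = sqrt 2 / fact r"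
    by (simp add: powr_add[symmetric] powr_half_sqrt)
  have eq: "(k * exp (of_real (- pi * x\<^sup>2))) * f (0 + (2 * sqrt pi) * t) =
      exp (2 * pi * \<i> * \<xi> * t) * hermite_fun r (t - x) * hermite_fun r t" for t
  proof -
    have arg: "- of_real pi * (of_real x)\<^sup>2 + (c * of_real (2 * sqrt pi * t) - (of_real (2 * sqrt pi * t))\<^sup>2 / 2)
       = 2 * pi * \<i> * \<xi> * t + (- of_real pi * (of_real (t - x))\<^sup>2 + - of_real pi * (of_real t)\<^sup>2)"
    proof -
      have "c * of_real (2 * sqrt pi * t) = (of_real (sqrt pi) * of_real (sqrt pi)) * (Complex x \<xi> * (2 * t))"
        by (simp add: c_def)
      moreover have "(complex_of_real (2 * sqrt pi * t))\<^sup>2 = of_real (pi * (4 * t\<^sup>2))"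
        unfolding of_real_power[symmetric] by (simp add: power_mult_distrib)
      ultimately show ?thesis unfolding pi2
        by (simp add: complex_eq_iff power2_eq_square field_simps)
    qed
    have "(k * exp (of_real (- pi * x\<^sup>2))) * f (0 + (2 * sqrt pi) * t) =
       k * hermite_poly r (of_real (2 * sqrt pi * t)) * hermite_poly r (of_real (2 * sqrt pi * (t - x))) *
       (exp (- of_real pi * (of_real x)\<^sup>2) * exp (c * of_real (2 * sqrt pi * t) - (of_real (2 * sqrt pi * t))\<^sup>2 / 2))"
      by (simp add: f_def b_def algebra_simps)
    also have "\<dots> = k * hermite_poly r (of_real (2 * sqrt pi * t)) * hermite_poly r (of_real (2 * sqrt pi * (t - x))) *
       (exp (2 * pi * \<i> * \<xi> * t) * (exp (- of_real pi * (of_real (t - x))\<^sup>2) * exp (- of_real pi * (of_real t)\<^sup>2)))"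
      by (simp only: exp_add[symmetric] arg)
    also have "\<dots> = exp (2 * pi * \<i> * \<xi> * t) * hermite_fun r (t - x) * hermite_fun r t"
      unfolding hermite_fun_eq k_def norm2[symmetric] of_real_mult by simp
    finally show ?thesis .
  qed
  have val: "(k * exp (of_real (- pi * x\<^sup>2))) * ((sqrt (2 * pi) * exp (c\<^sup>2 / 2) * fact r * laguerre r (pi * (x\<^sup>2 + \<xi>\<^sup>2))) /\<^sub>R \<bar>2 * sqrt pi\<bar>)
     = exp (\<i> * (pi * x * \<xi>)) * of_real (laguerre r (pi * (x\<^sup>2 + \<xi>\<^sup>2)) * exp (- (pi * (x\<^sup>2 + \<xi>\<^sup>2)) / 2))"
  proof -
    have const: "k * of_real (sqrt (2 * pi)) * fact r / of_real (2 * sqrt pi) = 1"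
    proof -
      have "sqrt 2 / fact r * sqrt (2 * pi) * fact r / (2 * sqrt pi) = 1"
        by (simp add: real_sqrt_mult field_simps)
      then have "complex_of_real (sqrt 2 / fact r * sqrt (2 * pi) * fact r / (2 * sqrt pi)) = of_real 1"
        by (rule arg_cong)
      then show ?thesis by (simp add: k_def)
    qed
    have arg: "- of_real pi * (of_real x)\<^sup>2 + c\<^sup>2 / 2 = \<i> * (pi * x * \<xi>) + of_real (- (pi * (x\<^sup>2 + \<xi>\<^sup>2)) / 2)"
    proof -
      have "c\<^sup>2 = (of_real (sqrt pi) * of_real (sqrt pi)) * (Complex x \<xi>)\<^sup>2"
        by (simp add: c_def power2_eq_square)
      then show ?thesis unfolding pi2
        by (simp add: complex_eq_iff power2_eq_square field_simps)
    qed
    have "(k * exp (of_real (- pi * x\<^sup>2))) * ((sqrt (2 * pi) * exp (c\<^sup>2 / 2) * fact r * laguerre r (pi * (x\<^sup>2 + \<xi>\<^sup>2))) /\<^sub>R \<bar>2 * sqrt pi\<bar>)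
       = (k * of_real (sqrt (2 * pi)) * fact r / of_real (2 * sqrt pi)) * of_real (laguerre r (pi * (x\<^sup>2 + \<xi>\<^sup>2)))
          * (exp (- of_real pi * (of_real x)\<^sup>2) * exp (c\<^sup>2 / 2))"
    proof -
      have abs: "\<bar>2 * sqrt pi\<bar> = 2 * sqrt pi" by simp
      have ex: "of_real (- pi * x\<^sup>2) = - of_real pi * (complex_of_real x)\<^sup>2" by simp
      show ?thesis
        unfolding scaleR_conv_of_real abs ex divide_inverse of_real_inverse by (simp only: ac_simps)
    qed
    also have "\<dots> = of_real (laguerre r (pi * (x\<^sup>2 + \<xi>\<^sup>2))) * (exp (\<i> * (pi * x * \<xi>)) * exp (of_real (- (pi * (x\<^sup>2 + \<xi>\<^sup>2)) / 2)))"
      unfolding const exp_add[symmetric] arg by simp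
    finally show ?thesis by (simp only: of_real_mult exp_of_real[symmetric] ac_simps)
  qed
  show ?thesis using * unfolding eq val .
qed

lemma tf_shift_apply:
  "tf_shift z g t = exp (2 * pi * \<i> * of_real (snd z) * of_real t) * g (t - fst z)"
  by (simp add: tf_shift_def split: prod.split)

lemma inner_tf_shift_hermite:
  "L2_inner (tf_shift u (hermite_fun r)) (hermite_fun r) =
     exp (\<i> * (pi * fst u * snd u)) * of_real (laguerre r (pi * (norm u)\<^sup>2) * exp (- (pi * (norm u)\<^sup>2) / 2))"
proof -
  have "L2_inner (tf_shift u (hermite_fun r)) (hermite_fun r) =
    (LINT t|lborel. exp (2 * pi * \<i> * snd u * t) * hermite_fun r (t - fst u) * hermite_fun r t)"
    unfolding L2_inner_def tf_shift_apply by (subst integral_completion) auto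
  then show ?thesis
    using hermite_fun_product_integral[of "snd u" r "fst u"] by (simp add: has_bochner_integral_iff norm_prod_def)
qed

lemma hermite_fun_square_integrable: "integrable lborel (\<lambda>t. (cmod (hermite_fun r t))\<^sup>2)"
proof -
  have "integrable lborel (\<lambda>t. hermite_fun r t * hermite_fun r t)"
    using hermite_fun_product_integral[of 0 r 0] by (simp add: has_bochner_integral_iff)
  then have "integrable lborel (\<lambda>t. cmod (hermite_fun r t * hermite_fun r t))"
    by (rule integrable_norm)
  then show ?thesis by (simp add: norm_mult power2_eq_square)
qed

section \<open>Averages over a disc\<close>

text \<open>An integral over the plane may be averaged over all rotations of its integrand. Exchanging the two
integrations then leaves a mean over a circle inside. The bound keeps the integrand integrable over
angle and plane together.\<close>

lemma integral_eq_rotation_average: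
  fixes g :: "real \<times> real \<Rightarrow> complex"
  assumes g [measurable]: "g \<in> borel_measurable borel"
    and bound: "\<And>u. norm (g u) \<le> B * indicator (ball 0 R) u"
  shows "(LINT u|lborel. g u) =
    (LINT u|lborel. (LINT s|lborel. indicator {0..1} s *\<^sub>R g (rotate_plane (- 2 * pi * s) u)))"
proof -
  define F where "F = (\<lambda>s u. indicator {0..1} s *\<^sub>R g (rotate_plane (- 2 * pi * s) u))"
  have rot: "(\<lambda>p. rotate_plane (- 2 * pi * fst p) (snd p)) \<in> borel_measurable (lborel \<Otimes>\<^sub>M lborel)"
    unfolding rotate_plane_def
    by (intro borel_measurable_lborel_pair_continuousI continuous_intros)
  have [measurable]: "(\<lambda>p. g (rotate_plane (- 2 * pi * fst p) (snd p))) \<in> borel_measurable (lborel \<Otimes>\<^sub>M lborel)"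
    by (rule measurable_compose[OF rot g])
  have meas: "case_prod F \<in> borel_measurable (lborel \<Otimes>\<^sub>M lborel)"
    unfolding F_def case_prod_beta' by measurable
  have dom: "integrable (lborel \<Otimes>\<^sub>M lborel) (\<lambda>p. B * indicator ({0..1::real} \<times> ball (0::real \<times> real) R) p)"
  proof (intro integrable_mult_right integrable_real_indicator)
    show "{0..1::real} \<times> ball (0::real \<times> real) R \<in> sets (lborel \<Otimes>\<^sub>M lborel)" by simp
    show "emeasure (lborel \<Otimes>\<^sub>M lborel) ({0..1::real} \<times> ball (0::real \<times> real) R) < \<infinity>"
      by (subst lborel.emeasure_pair_measure_Times)
        (use emeasure_lborel_ball_finite[of "0::real \<times> real" R] in \<open>auto simp: ennreal_mult_less_top\<close>)
  qed
  have int: "integrable (lborel \<Otimes>\<^sub>M lborel) (case_prod F)"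
  proof (rule Bochner_Integration.integrable_bound[OF dom meas], rule AE_I2, clarify)
    fix s :: real and x y :: real
    have "norm (g (rotate_plane (- 2 * pi * s) (x, y))) \<le> B * indicator (ball 0 R) (x, y)"
      using bound[of "rotate_plane (- 2 * pi * s) (x, y)"] by (simp add: norm_rotate_plane indicator_def)
    then show "norm (F s (x, y)) \<le> norm (B * indicator ({0..1} \<times> ball 0 R) (s, x, y))"
      by (auto simp: F_def indicator_def split: if_splits)
  qed
  have inner: "(LINT u|lborel. F s u) = indicator {0..1} s *\<^sub>R (LINT u|lborel. g u)" for s
  proof -
    have "(LINT u|lborel. g u) = (LINT u|distr lborel borel (rotate_plane (- 2 * pi * s)). g u)"
      by (simp only: lborel_rotate_plane)
    also have "\<dots> = (LINT u|lborel. g (rotate_plane (- 2 * pi * s) u))"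
      by (subst integral_distr) auto
    finally show ?thesis by (simp add: F_def)
  qed
  have "(LINT u|lborel. g u) = (LINT s|lborel. (LINT u|lborel. F s u))"
    unfolding inner by simp
  also have "\<dots> = (LINT u|lborel. (LINT s|lborel. F s u))"
    using lborel_pair.Fubini_integral[OF int] by simp
  finally show ?thesis unfolding F_def .
qed

text \<open>The circle mean integrated against a radial weight. The function $w$ is a multiple of
$x - i\xi$ rather than of $x + i\xi$, because the short-time Fourier transform contains the
conjugate of $\pi(u)h_r$, with modulation $e^{-2\pi i\xi t}$; accordingly it is a rotation by $-2\pi s$ that multiplies $w$ by
$e^{2\pi i s}$.\<close>

lemma disc_mean_hermite:
  fixes y :: real and \<phi> :: "real \<Rightarrow> real"
  assumes cont: "continuous_on UNIV \<phi>"
  defines "w \<equiv> \<lambda>u::real \<times> real. of_real (sqrt pi) * Complex (fst u) (- snd u)"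
  shows "(LINT u|lborel. indicator (ball 0 R) u * (of_real (\<phi> (pi * (norm u)\<^sup>2)) *
            (exp (of_real y * w u - (w u)\<^sup>2 / 2) * hermite_poly r (of_real y - w u - cnj (w u))))) =
    of_real (LINT u|lborel. indicator (ball 0 R) u * (\<phi> (pi * (norm (u::real \<times> real))\<^sup>2) * laguerre r (pi * (norm u)\<^sup>2)))
      * hermite_poly r (of_real y)"
proof -
  define \<psi> where "\<psi> = (\<lambda>w. exp (of_real y * w - w\<^sup>2 / 2) * hermite_poly r (of_real y - w - cnj w))"
  define h where "h = (\<lambda>u. of_real (\<phi> (pi * (norm u)\<^sup>2)) * \<psi> (w u))"
  define g where "g = (\<lambda>u. indicator (ball 0 R) u * h u)"
  have w_cont: "continuous_on UNIV w"
    unfolding w_def Complex_eq by (intro continuous_intros)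
  have \<psi>_cont: "continuous_on A (\<lambda>x. \<psi> (f x))" if "continuous_on A f" for A and f :: "'a::topological_space \<Rightarrow> complex"
    unfolding \<psi>_def by (intro continuous_intros that) auto
  have h_cont: "continuous_on UNIV h"
    unfolding h_def by (intro continuous_intros \<psi>_cont w_cont continuous_on_compose2[OF cont]) auto
  have h_meas [measurable]: "h \<in> borel_measurable borel"
    by (rule borel_measurable_continuous_onI[OF h_cont])
  have "bounded (h ` cball 0 R)"
    by (intro compact_imp_bounded compact_continuous_image continuous_on_subset[OF h_cont]) auto
  then obtain B where B: "\<And>u. u \<in> cball 0 R \<Longrightarrow> norm (h u) \<le> B"
    unfolding bounded_iff by blast
  have bound: "norm (g u) \<le> B * indicator (ball 0 R) u" for u
    using B[of u] by (auto simp: g_def indicator_def)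
  have g_meas: "g \<in> borel_measurable borel"
    unfolding g_def by (intro borel_measurable_times borel_measurable_indicator h_meas) auto
  have w_rot: "w (rotate_plane (- 2 * pi * s) u) = w u * exp (2 * pi * \<i> * of_real s)" for s u
  proof -
    have "exp (2 * pi * \<i> * of_real s) = Complex (cos (2 * pi * s)) (sin (2 * pi * s))"
      using cis_conv_exp[of "2 * pi * s"] by (simp add: cis.code ac_simps)
    then show ?thesis
      by (simp add: w_def rotate_plane_def complex_eq_iff algebra_simps)
  qed
  have inner: "(LINT s|lborel. indicator {0..1} s *\<^sub>R g (rotate_plane (- 2 * pi * s) u)) =
     of_real (indicator (ball 0 R) u * (\<phi> (pi * (norm u)\<^sup>2) * laguerre r (pi * (norm u)\<^sup>2))) * hermite_poly r (of_real y)" for u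
  proof -
    have normw: "(cmod (w u))\<^sup>2 = pi * (norm u)\<^sup>2"
      by (simp add: w_def norm_mult power_mult_distrib cmod_def norm_prod_def distrib_left)
    have mean: "((\<lambda>s::real. \<psi> (w u * exp (2 * pi * \<i> * of_real s))) has_integral laguerre r (pi * (norm u)\<^sup>2) * hermite_poly r (complex_of_real y)) {0..1}"
      using circle_mean_hermite[of "w u" "of_real y" r] unfolding \<psi>_def Let_def normw .
    have "set_integrable lborel {0..1} (\<lambda>s::real. \<psi> (w u * exp (2 * pi * \<i> * of_real s)))"
      by (intro borel_integrable_atLeastAtMost' \<psi>_cont continuous_intros)
    from set_borel_integral_eq_integral(2)[OF this]
    have L: "(LINT s|lborel. indicator {0..1} s *\<^sub>R \<psi> (w u * exp (2 * pi * \<i> * of_real s))) = laguerre r (pi * (norm u)\<^sup>2) * hermite_poly r (complex_of_real y)"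
      using integral_unique[OF mean] by (simp add: set_lebesgue_integral_def)
    have "indicator {0..1} s *\<^sub>R g (rotate_plane (- 2 * pi * s) u) =
      (indicator (ball 0 R) u * of_real (\<phi> (pi * (norm u)\<^sup>2))) * (indicator {0..1} s *\<^sub>R \<psi> (w u * exp (2 * pi * \<i> * of_real s)))" for s
      unfolding g_def h_def w_rot by (simp add: norm_rotate_plane indicator_def)
    then have "(LINT s|lborel. indicator {0..1} s *\<^sub>R g (rotate_plane (- 2 * pi * s) u)) =
       (indicator (ball 0 R) u * of_real (\<phi> (pi * (norm u)\<^sup>2))) * (laguerre r (pi * (norm u)\<^sup>2) * hermite_poly r (complex_of_real y))"
      by (simp only: integral_mult_right_zero L)
    then show ?thesis by (simp add: indicator_def)
  qed
  have "(LINT u|lborel. g u) =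
     (LINT u|lborel. of_real (indicator (ball (0 :: real \<times> real) R) u * (\<phi> (pi * (norm u)\<^sup>2) * laguerre r (pi * (norm u)\<^sup>2))) * hermite_poly r (of_real y))"
    unfolding integral_eq_rotation_average[OF g_meas bound] inner ..
  also have "\<dots> = of_real (LINT u|lborel. indicator (ball 0 R) u * (\<phi> (pi * (norm (u::real \<times> real))\<^sup>2) * laguerre r (pi * (norm u)\<^sup>2)))
      * hermite_poly r (of_real y)"
    by (simp only: integral_mult_left_zero integral_complex_of_real)
  finally show ?thesis unfolding g_def h_def \<psi>_def .
qed

section \<open>Time-frequency shifts of Hermite functions averaged over a disc\<close>

lemma borel_measurable_cnj [measurable]: "cnj \<in> borel_measurable borel"
  by (intro borel_measurable_continuous_onI continuous_intros)

lemma continuous_on_laguerre [continuous_intros]: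
  fixes f :: "'a::topological_space \<Rightarrow> real"
  assumes "continuous_on A f"
  shows "continuous_on A (\<lambda>x. laguerre r (f x))"
  unfolding laguerre_def by (intro continuous_intros assms) auto

lemma borel_measurable_laguerre [measurable]: "laguerre r \<in> borel_measurable borel"
  using continuous_on_laguerre[OF continuous_on_id] by (rule borel_measurable_continuous_onI)

definition disc_const :: "nat \<Rightarrow> nat \<Rightarrow> real \<Rightarrow> real" where
  "disc_const j r R = (LINT t|lborel. indicator {0..pi * R\<^sup>2} t * (laguerre r t * laguerre j t * exp (- t)))"

lemma disc_const_eq:
  assumes "R > 0"
  shows "disc_const j r R = (LINT u|lborel. indicator (ball (0::real \<times> real) R) u *
      (laguerre r (pi * (norm u)\<^sup>2) * laguerre j (pi * (norm u)\<^sup>2) * exp (- (pi * (norm u)\<^sup>2))))"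
  unfolding disc_const_def
  by (rule integral_radial_disc[symmetric, where \<phi> = "\<lambda>t. laguerre r t * laguerre j t * exp (- t)", OF assms])
    (intro borel_measurable_continuous_onI continuous_intros)

lemma continuous_on_tf_shift_hermite [continuous_intros]:
  fixes p :: "'a::topological_space \<Rightarrow> real \<times> real"
  assumes "continuous_on A p" "continuous_on A q"
  shows "continuous_on A (\<lambda>x. tf_shift (p x) (hermite_fun r) (q x))"
  unfolding tf_shift_apply by (intro continuous_intros assms)

lemma borel_measurable_tf_shift_hermite [measurable]: "tf_shift z (hermite_fun r) \<in> borel_measurable borel"
  by (intro borel_measurable_continuous_onI continuous_intros)

lemma norm_tf_shift: "norm (tf_shift z g t) = norm (g (t - fst z))"
  by (simp add: tf_shift_apply norm_mult)

text \<open>Time-frequency shifts compose up to a phase. It depends on $z$ and $u$ alone; in the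
reproducing formula it occurs in the kernel and, conjugated, in the transform, so that it cancels.\<close>

lemma tf_shift_add:
  "tf_shift (z + u) g s =
     exp (2 * pi * \<i> * of_real (snd u * fst z)) * (exp (2 * pi * \<i> * of_real (snd z * s)) * tf_shift u g (s - fst z))"
proof -
  have "exp (2 * pi * \<i> * of_real (snd (z + u)) * of_real s) =
    exp (2 * pi * \<i> * of_real (snd u * fst z)) * (exp (2 * pi * \<i> * of_real (snd z * s)) * exp (2 * pi * \<i> * of_real (snd u) * of_real (s - fst z)))"
    by (simp add: exp_add[symmetric] algebra_simps)
  then show ?thesis by (simp add: tf_shift_apply diff_diff_eq)
qed

lemma phase_mult_cnj: "cnj (exp (2 * pi * \<i> * of_real a)) * exp (2 * pi * \<i> * of_real a) = 1"
  "exp (2 * pi * \<i> * of_real a) * cnj (exp (2 * pi * \<i> * of_real a)) = 1"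
  by (simp_all add: exp_cnj exp_add[symmetric])

lemma stft_kernel_hermite:
  "stft_kernel (hermite_fun j) z (z + u) =
     exp (2 * pi * \<i> * of_real (snd u * fst z)) * L2_inner (tf_shift u (hermite_fun j)) (hermite_fun j)"
proof -
  let ?h = "hermite_fun j" and ?p = "exp (2 * pi * \<i> * of_real (snd u * fst z))"
  have "tf_shift (z + u) ?h s * cnj (tf_shift z ?h s) =
      ?p * (tf_shift u ?h (- fst z + 1 * s) * ?h (- fst z + 1 * s))" for s
  proof -
    define e where "e = exp (2 * pi * \<i> * of_real (snd z * s))"
    have z: "tf_shift z ?h s = e * ?h (s - fst z)"
      by (simp add: tf_shift_apply e_def mult.assoc)
    have "tf_shift (z + u) ?h s * cnj (tf_shift z ?h s) =
      (e * cnj e) * (?p * (tf_shift u ?h (s - fst z) * ?h (s - fst z)))"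
      unfolding tf_shift_add z complex_cnj_mult hermite_fun_cnj e_def by (simp only: ac_simps)
    also have "e * cnj e = 1" unfolding e_def by (rule phase_mult_cnj)
    finally show ?thesis by (simp add: algebra_simps)
  qed
  then have "stft_kernel ?h z (z + u) =
      (LINT s|lebesgue. ?p * (tf_shift u ?h (- fst z + 1 * s) * ?h (- fst z + 1 * s)))"
    by (simp only: stft_kernel_def L2_inner_def)
  also have "\<dots> = (LINT s|lborel. ?p * (tf_shift u ?h (- fst z + 1 * s) * ?h (- fst z + 1 * s)))"
    by (rule integral_completion) measurable
  also have "\<dots> = ?p * (LINT s|lborel. tf_shift u ?h s * ?h s)"
    by (subst lborel_integral_real_affine[of 1 "\<lambda>s. tf_shift u ?h s * ?h s" "- fst z"]) simp_all
  also have "(LINT s|lborel. tf_shift u ?h s * ?h s) = L2_inner (tf_shift u ?h) ?h"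
    unfolding L2_inner_def hermite_fun_cnj by (rule integral_completion[symmetric]) measurable
  finally show ?thesis .
qed

text \<open>The averages of $\overline{\pi(u)h_r}$ over the disc, weighted by the ambiguity function of $h_j$,
reproduce $h_r$ up to the constant. Collecting exponents, the phase $e^{i\pi x\xi}$ of the
ambiguity function is exactly what turns $\overline{\pi(u)h_r}$ into the generating function
$e^{yw - w^2/2}$ times $H_r(y - w - \overline{w})$, up to the Gaussian $e^{-\pi t^2}$ and a radial
factor.\<close>

lemma disc_synthesis_hermite:
  assumes "R > 0"
  shows "(LINT u|lborel. indicator (ball 0 R) u *
      (L2_inner (tf_shift u (hermite_fun j)) (hermite_fun j) * cnj (tf_shift u (hermite_fun r) t))) =
    of_real (disc_const j r R) * hermite_fun r t"
proof -
  define w where "w = (\<lambda>u::real \<times> real. of_real (sqrt pi) * Complex (fst u) (- snd u))"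
  define y where "y = 2 * sqrt pi * t"
  define \<phi> where "\<phi> = (\<lambda>q. laguerre j q * exp (- q))"
  define k where "k = complex_of_real (2 powr (1/4) / sqrt (fact r)) * exp (of_real (- pi * t\<^sup>2))"
  have pi2: "of_real (sqrt pi) * of_real (sqrt pi) = complex_of_real pi"
    by (metis of_real_mult real_sqrt_mult_self abs_of_nonneg pi_ge_zero)
  have integrand: "indicator (ball 0 R) u *
      (L2_inner (tf_shift u (hermite_fun j)) (hermite_fun j) * cnj (tf_shift u (hermite_fun r) t)) =
    k * (indicator (ball 0 R) u * (of_real (\<phi> (pi * (norm u)\<^sup>2)) *
        (exp (of_real y * w u - (w u)\<^sup>2 / 2) * hermite_poly r (of_real y - w u - cnj (w u)))))" for u
  proof -
    obtain x \<xi> where u: "u = (x, \<xi>)" by (cases u)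
    define q where "q = pi * (norm u)\<^sup>2"
    have q: "q = pi * (x\<^sup>2 + \<xi>\<^sup>2)" by (simp add: q_def u norm_prod_def)
    have yw: "of_real y - w u - cnj (w u) = of_real (2 * sqrt pi * (t - x))"
      by (simp add: y_def w_def u complex_eq_iff algebra_simps)
    have arg: "\<i> * (pi * x * \<xi>) + (of_real (- q / 2) + (- (2 * pi * \<i> * \<xi> * t) + of_real (- pi * (t - x)\<^sup>2))) =
        of_real (- pi * t\<^sup>2) + (of_real (- q) + (of_real y * w u - (w u)\<^sup>2 / 2))"
    proof -
      have "of_real y * w u = (of_real (sqrt pi) * of_real (sqrt pi)) * (2 * t * Complex x (- \<xi>))"
        by (simp add: y_def w_def u)
      moreover have "(w u)\<^sup>2 = (of_real (sqrt pi) * of_real (sqrt pi)) * (Complex x (- \<xi>))\<^sup>2"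
        by (simp add: w_def u power2_eq_square)
      ultimately show ?thesis
        unfolding pi2 q by (simp add: complex_eq_iff power2_eq_square field_simps)
    qed
    have A: "L2_inner (tf_shift u (hermite_fun j)) (hermite_fun j) =
        exp (\<i> * (pi * x * \<xi>)) * (of_real (laguerre j q) * exp (of_real (- q / 2)))"
      unfolding inner_tf_shift_hermite of_real_mult exp_of_real q_def[symmetric] by (simp add: u exp_of_real)
    have T: "cnj (tf_shift u (hermite_fun r) t) = of_real (2 powr (1/4) / sqrt (fact r)) *
        hermite_poly r (of_real (2 * sqrt pi * (t - x))) * (exp (- (2 * pi * \<i> * \<xi> * t)) * exp (of_real (- pi * (t - x)\<^sup>2)))"
      unfolding tf_shift_apply complex_cnj_mult hermite_fun_cnj unfolding hermite_fun_eq u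
      by (simp add: exp_cnj)
    have "L2_inner (tf_shift u (hermite_fun j)) (hermite_fun j) * cnj (tf_shift u (hermite_fun r) t) =
      of_real (2 powr (1/4) / sqrt (fact r)) * of_real (laguerre j q) * hermite_poly r (of_real (2 * sqrt pi * (t - x))) *
      (exp (\<i> * (pi * x * \<xi>)) * (exp (of_real (- q / 2)) * (exp (- (2 * pi * \<i> * \<xi> * t)) * exp (of_real (- pi * (t - x)\<^sup>2)))))"
      unfolding A T by (simp only: ac_simps)
    also have "\<dots> = of_real (2 powr (1/4) / sqrt (fact r)) * of_real (laguerre j q) * hermite_poly r (of_real y - w u - cnj (w u)) *
      (exp (of_real (- pi * t\<^sup>2)) * (exp (of_real (- q)) * exp (of_real y * w u - (w u)\<^sup>2 / 2)))"
      unfolding yw by (simp only: exp_add[symmetric] arg)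
    also have "\<dots> = k * (of_real (\<phi> q) * (exp (of_real y * w u - (w u)\<^sup>2 / 2) * hermite_poly r (of_real y - w u - cnj (w u))))"
      unfolding k_def \<phi>_def of_real_mult exp_of_real by (simp only: ac_simps)
    finally show ?thesis unfolding q_def by (simp only: ac_simps)
  qed
  have "(LINT u|lborel. indicator (ball 0 R) u *
      (L2_inner (tf_shift u (hermite_fun j)) (hermite_fun j) * cnj (tf_shift u (hermite_fun r) t))) =
    k * (of_real (LINT u|lborel. indicator (ball 0 R) u * (\<phi> (pi * (norm (u::real \<times> real))\<^sup>2) * laguerre r (pi * (norm u)\<^sup>2)))
      * hermite_poly r (of_real y))"
    unfolding integrand integral_mult_right_zero w_def
    by (subst disc_mean_hermite) (auto simp: \<phi>_def intro!: continuous_intros)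
  also have "(LINT u|lborel. indicator (ball 0 R) u * (\<phi> (pi * (norm (u::real \<times> real))\<^sup>2) * laguerre r (pi * (norm u)\<^sup>2))) = disc_const j r R"
    unfolding disc_const_eq[OF assms] \<phi>_def by (simp only: ac_simps)
  finally show ?thesis
    unfolding hermite_fun_eq k_def y_def by (simp only: ac_simps)
qed

text \<open>The phases of the two ambiguity functions cancel, and a radial integrand remains.\<close>

lemma local_const_eq:
  assumes "R > 0"
  shows "local_const j r R = of_real (disc_const j r R)"
proof -
  have stft: "stft (hermite_fun n) (hermite_fun n) u = cnj (L2_inner (tf_shift u (hermite_fun n)) (hermite_fun n))" for n u
    unfolding stft_def L2_inner_def
    by (subst Bochner_Integration.integral_cnj[symmetric]) (simp add: mult.commute del: Bochner_Integration.integral_cnj)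
  have integrand: "indicator (disc R) u * stft (hermite_fun r) (hermite_fun r) u * cnj (stft (hermite_fun j) (hermite_fun j) u) =
     of_real (indicator (ball 0 R) u * (laguerre r (pi * (norm u)\<^sup>2) * laguerre j (pi * (norm u)\<^sup>2) * exp (- (pi * (norm u)\<^sup>2))))" for u
  proof -
    define p where "p = exp (\<i> * complex_of_real (pi * fst u * snd u))"
    define q where "q = pi * (norm u)\<^sup>2"
    have p: "cnj p * p = 1" by (simp add: p_def exp_cnj exp_add[symmetric])
    have e: "exp (- q / 2) * exp (- q / 2) = exp (- q)" by (simp add: exp_add[symmetric])
    have "stft (hermite_fun r) (hermite_fun r) u * cnj (stft (hermite_fun j) (hermite_fun j) u) =
      (cnj p * p) * of_real (laguerre r q * laguerre j q * (exp (- q / 2) * exp (- q / 2)))"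
      unfolding stft complex_cnj_cnj inner_tf_shift_hermite p_def[symmetric] q_def[symmetric]
      by (simp only: complex_cnj_mult complex_cnj_complex_of_real of_real_mult ac_simps)
    then have "stft (hermite_fun r) (hermite_fun r) u * cnj (stft (hermite_fun j) (hermite_fun j) u) =
        of_real (laguerre r q * laguerre j q * exp (- q))"
      by (simp only: p e mult_1_left)
    then show ?thesis
      unfolding q_def by (simp add: disc_def indicator_def)
  qed
  define g where "g = (\<lambda>u::real \<times> real. laguerre r (pi * (norm u)\<^sup>2) * laguerre j (pi * (norm u)\<^sup>2) * exp (- (pi * (norm u)\<^sup>2)))"
  have g: "g \<in> borel_measurable borel"
    unfolding g_def by (intro borel_measurable_continuous_onI continuous_intros)
  have "(\<lambda>u. indicator (ball 0 R) u * g u) \<in> borel_measurable borel"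
    by (intro borel_measurable_times borel_measurable_indicator g) auto
  then have meas: "(\<lambda>u. complex_of_real (indicator (ball 0 R) u * g u)) \<in> borel_measurable lborel"
    unfolding measurable_lborel2 by (rule measurable_compose[OF _ borel_measurable_of_real])
  have "local_const j r R = (LINT u|lebesgue. complex_of_real (indicator (ball 0 R) u * g u))"
    unfolding local_const_def L2_inner_def integrand g_def ..
  also have "\<dots> = (LINT u|lborel. complex_of_real (indicator (ball 0 R) u * g u))"
    by (rule integral_completion[OF meas])
  finally show ?thesis
    unfolding disc_const_eq[OF assms] g_def by (simp only: integral_complex_of_real)
qed

section \<open>Reproduction of short-time Fourier transforms from a disc\<close>

text \<open>A double integral of $f(s)$ against shifts of $h_r$ needs measurability for a product
$\sigma$-algebra, which the Borel sets provide. Short-time Fourier transforms do not see the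
change of representative.\<close>

lemma L2_borel_representative:
  fixes f :: "real \<Rightarrow> complex"
  assumes "f \<in> L2"
  obtains f' where "f' \<in> borel_measurable borel" "integrable lborel (\<lambda>x. (cmod (f' x))\<^sup>2)" "AE x in lebesgue. f x = f' x"
proof -
  have f [measurable]: "f \<in> borel_measurable lebesgue" and int: "integrable lebesgue (\<lambda>x. (cmod (f x))\<^sup>2)"
    using assms by (auto simp: L2_def)
  obtain a where a: "a \<in> borel_measurable lborel" "AE x in lborel. Re (f x) = a x"
    using completion_ex_borel_measurable_real[of "\<lambda>x. Re (f x)" lborel] by auto
  obtain b where b: "b \<in> borel_measurable lborel" "AE x in lborel. Im (f x) = b x"
    using completion_ex_borel_measurable_real[of "\<lambda>x. Im (f x)" lborel] by auto
  define f' where "f' = (\<lambda>x. of_real (a x) + \<i> * of_real (b x))"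
  have f' [measurable]: "f' \<in> borel_measurable borel"
    using a(1) b(1) unfolding f'_def by simp
  have "AE x in lborel. f x = f' x"
    using a(2) b(2) by eventually_elim (simp add: f'_def complex_eq_iff)
  then have AE: "AE x in lebesgue. f x = f' x"
    by (rule AE_completion)
  have f'_leb: "f' \<in> borel_measurable lebesgue"
    by (intro measurable_completion) simp
  have "integrable lebesgue (\<lambda>x. (cmod (f' x))\<^sup>2)"
  proof (rule integrable_cong_AE_imp[OF int])
    show "(\<lambda>x. (cmod (f' x))\<^sup>2) \<in> borel_measurable lebesgue"
      using f'_leb by measurable
    show "AE x in lebesgue. (cmod (f x))\<^sup>2 = (cmod (f' x))\<^sup>2"
      using AE by eventually_elim simp
  qed
  then have "integrable lborel (\<lambda>x. (cmod (f' x))\<^sup>2)"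
    by (subst (asm) integrable_completion) auto
  from f' this AE show thesis by (rule that)
qed

lemma stft_borel:
  assumes [measurable]: "f \<in> borel_measurable borel"
  shows "stft (hermite_fun r) f z = (LINT s|lborel. f s * cnj (tf_shift z (hermite_fun r) s))"
  unfolding stft_def L2_inner_def by (rule integral_completion) measurable

lemma stft_cong_AE:
  assumes "f \<in> borel_measurable lebesgue" "f' \<in> borel_measurable lebesgue" "AE x in lebesgue. f x = f' x"
  shows "stft (hermite_fun r) f z = stft (hermite_fun r) f' z"
  unfolding stft_def L2_inner_def
proof (rule integral_cong_AE)
  have h: "(\<lambda>s. cnj (tf_shift z (hermite_fun r) s)) \<in> borel_measurable lebesgue"
    by (intro measurable_completion) measurable
  show "(\<lambda>x. f x * cnj (tf_shift z (hermite_fun r) x)) \<in> borel_measurable lebesgue"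
    "(\<lambda>x. f' x * cnj (tf_shift z (hermite_fun r) x)) \<in> borel_measurable lebesgue"
    using assms h by (auto intro!: borel_measurable_times)
  show "AE x in lebesgue. f x * cnj (tf_shift z (hermite_fun r) x) = f' x * cnj (tf_shift z (hermite_fun r) x)"
    using assms(3) by eventually_elim simp
qed

lemma continuous_on_inner_tf_shift_hermite [continuous_intros]:
  fixes p :: "'a::topological_space \<Rightarrow> real \<times> real"
  assumes "continuous_on A p"
  shows "continuous_on A (\<lambda>x. L2_inner (tf_shift (p x) (hermite_fun j)) (hermite_fun j))"
  unfolding inner_tf_shift_hermite by (intro continuous_intros assms) auto

lemma borel_measurable_stft:
  assumes f [measurable]: "f \<in> borel_measurable borel"
  shows "stft (hermite_fun r) f \<in> borel_measurable borel"
proof -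
  have "(\<lambda>p. tf_shift (fst p) (hermite_fun r) (snd p)) \<in> borel_measurable (lborel \<Otimes>\<^sub>M lborel)"
    by (intro borel_measurable_lborel_pair_continuousI continuous_intros)
  then have "(\<lambda>p. f (snd p) * cnj (tf_shift (fst p) (hermite_fun r) (snd p))) \<in> borel_measurable (lborel \<Otimes>\<^sub>M lborel)"
    by measurable
  then have "(\<lambda>z. LINT s|lborel. f s * cnj (tf_shift z (hermite_fun r) s)) \<in> borel_measurable lborel"
    by (intro lborel.borel_measurable_lebesgue_integral) (simp add: case_prod_beta')
  then show ?thesis
    unfolding stft_borel[OF f, abs_def] by simp
qed

text \<open>The integrand $|f(s)|\,|h_r(s - \cdot)|$ of the double integral is below the sum of the squares.
Integrating the latter over $s$ first gives the same finite value for every point of the disc.\<close>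

lemma integrable_hermite_translates:
  fixes f :: "real \<Rightarrow> complex"
  assumes f [measurable]: "f \<in> borel_measurable borel" and f2: "integrable lborel (\<lambda>s. (cmod (f s))\<^sup>2)"
  shows "integrable (lborel \<Otimes>\<^sub>M lborel) (\<lambda>p. indicator (ball (0::real \<times> real) R) (fst p) *
      ((cmod (f (snd p)))\<^sup>2 + (cmod (hermite_fun r (snd p - x - fst (fst p))))\<^sup>2))"
proof -
  define I where "I = (LINT s|lborel. (cmod (f s))\<^sup>2) + (LINT s|lborel. (cmod (hermite_fun r s))\<^sup>2)"
  define D where "D = (\<lambda>p. indicator (ball (0::real \<times> real) R) (fst p) *
      ((cmod (f (snd p)))\<^sup>2 + (cmod (hermite_fun r (snd p - x - fst (fst p))))\<^sup>2))"
  have shift: "integrable lborel (\<lambda>s. (cmod (hermite_fun r (s - x - fst u)))\<^sup>2)"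
    "(LINT s|lborel. (cmod (hermite_fun r (s - x - fst u)))\<^sup>2) = (LINT s|lborel. (cmod (hermite_fun r s))\<^sup>2)" for u :: "real \<times> real"
    using lborel_integrable_real_affine[OF hermite_fun_square_integrable[of r], of 1 "- x - fst u"]
      lborel_integral_real_affine[of 1 "\<lambda>s. (cmod (hermite_fun r s))\<^sup>2" "- x - fst u"]
    by (simp_all add: algebra_simps)
  have ball [measurable]: "indicator (ball (0::real \<times> real) R) \<in> borel_measurable (lborel :: (real \<times> real) measure)"
    by (rule borel_measurable_indicator) simp
  show ?thesis
    unfolding D_def[symmetric]
  proof (rule lborel_pair.Fubini_integrable)
    have [measurable]: "(\<lambda>p. (cmod (hermite_fun r (snd p - x - fst (fst p))))\<^sup>2) \<in> borel_measurable ((lborel :: (real \<times> real) measure) \<Otimes>\<^sub>M lborel)"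
      by (intro borel_measurable_lborel_pair_continuousI continuous_intros)
    show "D \<in> borel_measurable (lborel \<Otimes>\<^sub>M lborel)"
      unfolding D_def by measurable
    have slice: "integrable lborel (\<lambda>s. D (u, s))" "(LINT s|lborel. norm (D (u, s))) = indicator (ball 0 R) u * I" for u
      unfolding D_def I_def using f2 shift[of u] by (auto simp: abs_mult)
    then show "AE u in lborel. integrable lborel (\<lambda>s. D (u, s))" by simp
    have "integrable lborel (\<lambda>u. indicator (ball (0::real \<times> real) R) u * I)"
      by (intro integrable_mult_left integrable_real_indicator emeasure_lborel_ball_finite) simp
    then show "integrable lborel (\<lambda>u. LINT s|lborel. norm (D (u, s)))"
      unfolding slice .
  qed
qed

text \<open>By Fubini the integral over the disc is taken first, at a fixed point $s$. Apart from $f(s)$ and the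
modulation belonging to $z$, which do not depend on $u$, it is the synthesis of $h_r$ over the disc,
evaluated at $s$ minus the first coordinate of $z$.\<close>

lemma stft_disc_reproduction:
  fixes f :: "real \<Rightarrow> complex"
  assumes f [measurable]: "f \<in> borel_measurable borel" and f2: "integrable lborel (\<lambda>s. (cmod (f s))\<^sup>2)" and "R > 0"
  shows "(LINT u|lborel. indicator (ball 0 R) u * (stft (hermite_fun r) f (z + u) * stft_kernel (hermite_fun j) z (z + u))) =
    of_real (disc_const j r R) * stft (hermite_fun r) f z"
proof -
  let ?h = "hermite_fun r"
  define amb where "amb = (\<lambda>u. L2_inner (tf_shift u (hermite_fun j)) (hermite_fun j))"
  define a where "a = (\<lambda>s. f s * cnj (exp (2 * pi * \<i> * of_real (snd z * s))))"
  define F where "F = (\<lambda>u s. indicator (ball 0 R) u * (a s * (amb u * cnj (tf_shift u ?h (s - fst z)))))"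
  have pointwise: "indicator (ball 0 R) u * (stft ?h f (z + u) * stft_kernel (hermite_fun j) z (z + u)) = (LINT s|lborel. F u s)" for u
  proof -
    define p where "p = exp (2 * pi * \<i> * of_real (snd u * fst z))"
    have "f s * cnj (tf_shift (z + u) ?h s) * (p * amb u) = (cnj p * p) * (a s * (amb u * cnj (tf_shift u ?h (s - fst z))))" for s
      unfolding tf_shift_add a_def p_def complex_cnj_mult by (simp only: ac_simps)
    moreover have "cnj p * p = 1" unfolding p_def by (rule phase_mult_cnj)
    ultimately have "f s * cnj (tf_shift (z + u) ?h s) * (p * amb u) = a s * (amb u * cnj (tf_shift u ?h (s - fst z)))" for s
      by (simp only: mult_1_left)
    then have "F u s = indicator (ball 0 R) u * (f s * cnj (tf_shift (z + u) ?h s) * (p * amb u))" for s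
      by (simp only: F_def)
    moreover have "stft_kernel (hermite_fun j) z (z + u) = p * amb u"
      by (simp only: stft_kernel_hermite amb_def p_def)
    ultimately show ?thesis
      unfolding stft_borel[OF f]
      by (simp only: integral_mult_right_zero integral_mult_left_zero)
  qed
  have amb_cont: "continuous_on UNIV amb"
    unfolding amb_def by (intro continuous_intros)
  have "bounded (amb ` cball 0 R)"
    by (intro compact_imp_bounded compact_continuous_image continuous_on_subset[OF amb_cont]) auto
  then obtain M where M: "\<And>u. u \<in> cball 0 R \<Longrightarrow> norm (amb u) \<le> M"
    unfolding bounded_iff by blast
  have M0: "M \<ge> 0" using M[of 0] \<open>R > 0\<close> by (meson centre_in_cball less_imp_le norm_ge_zero order_trans)
  have int: "integrable (lborel \<Otimes>\<^sub>M lborel) (case_prod F)"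
  proof (rule Bochner_Integration.integrable_bound)
    show "integrable (lborel \<Otimes>\<^sub>M lborel) (\<lambda>p. M * (indicator (ball (0::real \<times> real) R) (fst p) *
      ((cmod (f (snd p)))\<^sup>2 + (cmod (?h (snd p - fst z - fst (fst p))))\<^sup>2)))"
      by (intro integrable_mult_right integrable_hermite_translates f f2)
    have [measurable]: "(\<lambda>p. amb (fst p) * cnj (tf_shift (fst p) ?h (snd p - fst z))) \<in> borel_measurable ((lborel :: (real \<times> real) measure) \<Otimes>\<^sub>M lborel)"
      unfolding amb_def
      by (intro borel_measurable_lborel_pair_continuousI continuous_intros)
    have [measurable]: "a \<in> borel_measurable lborel"
      unfolding a_def by measurable
    have [measurable]: "indicator (ball (0::real \<times> real) R) \<in> borel_measurable (lborel :: (real \<times> real) measure)"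
      by (rule borel_measurable_indicator) simp
    show "case_prod F \<in> borel_measurable (lborel \<Otimes>\<^sub>M lborel)"
      unfolding F_def case_prod_beta' by measurable
    \<comment> \<open>the ambiguity function is bounded on the disc, and a product of absolute values is below the sum of the squares\<close>
    have bound: "norm (F u s) \<le> M * (indicator (ball 0 R) u * ((cmod (f s))\<^sup>2 + (cmod (?h (s - fst z - fst u)))\<^sup>2))" for u s
    proof (cases "u \<in> ball 0 R")
      case True
      have "cmod (a s) = cmod (f s)" by (simp add: a_def norm_mult)
      then have "norm (F u s) = cmod (amb u) * (cmod (f s) * cmod (?h (s - fst z - fst u)))"
        using True by (simp add: F_def norm_mult norm_tf_shift)
      also have "\<dots> \<le> M * ((cmod (f s))\<^sup>2 + (cmod (?h (s - fst z - fst u)))\<^sup>2)"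
      proof (rule mult_mono)
        have "2 * (cmod (f s) * cmod (?h (s - fst z - fst u))) \<le> (cmod (f s))\<^sup>2 + (cmod (?h (s - fst z - fst u)))\<^sup>2"
          using sum_squares_bound[of "cmod (f s)" "cmod (?h (s - fst z - fst u))"] by simp
        moreover have "0 \<le> cmod (f s) * cmod (?h (s - fst z - fst u))" by simp
        ultimately show "cmod (f s) * cmod (?h (s - fst z - fst u)) \<le> (cmod (f s))\<^sup>2 + (cmod (?h (s - fst z - fst u)))\<^sup>2"
          by linarith
      qed (use M[of u] True M0 in auto)
      finally show ?thesis using True by simp
    qed (simp add: F_def)
    show "AE p in lborel \<Otimes>\<^sub>M lborel. norm (case_prod F p) \<le> norm (M * (indicator (ball (0::real \<times> real) R) (fst p) *
      ((cmod (f (snd p)))\<^sup>2 + (cmod (?h (snd p - fst z - fst (fst p))))\<^sup>2)))"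
      unfolding case_prod_beta' real_norm_def
      by (intro AE_I2 order_trans[OF bound abs_ge_self])
  qed
  have inner: "(LINT u|lborel. F u s) = of_real (disc_const j r R) * (f s * cnj (tf_shift z ?h s))" for s
  proof -
    have "(LINT u|lborel. F u s) = (LINT u|lborel. a s * (indicator (ball 0 R) u * (amb u * cnj (tf_shift u ?h (s - fst z)))))"
      unfolding F_def by (simp only: ac_simps)
    also have "\<dots> = a s * (of_real (disc_const j r R) * ?h (s - fst z))"
      unfolding amb_def integral_mult_right_zero disc_synthesis_hermite[OF \<open>R > 0\<close>] ..
    also have "\<dots> = of_real (disc_const j r R) * (f s * cnj (tf_shift z ?h s))"
      by (simp add: a_def tf_shift_apply mult.assoc)
    finally show ?thesis .
  qed
  have "(LINT u|lborel. indicator (ball 0 R) u * (stft ?h f (z + u) * stft_kernel (hermite_fun j) z (z + u))) =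
      (LINT u|lborel. (LINT s|lborel. F u s))"
    unfolding pointwise ..
  also have "\<dots> = (LINT s|lborel. (LINT u|lborel. F u s))"
    using lborel_pair.Fubini_integral[OF int] by simp
  also have "\<dots> = of_real (disc_const j r R) * stft ?h f z"
    unfolding inner integral_mult_right_zero stft_borel[OF f] ..
  finally show ?thesis .
qed

lemma set_integral_translated_disc:
  fixes G :: "real \<times> real \<Rightarrow> complex"
  assumes G [measurable]: "G \<in> borel_measurable borel"
  shows "(LINT w:((\<lambda>u. z + u) ` disc R)|lebesgue. G w) = (LINT u|lborel. indicator (ball 0 R) u * G (z + u))"
proof -
  have image: "(\<lambda>u. z + u) ` disc R = ball z R"
    using ball_translation[of z 0 R] by (simp add: disc_def)
  have meas: "(\<lambda>w. indicator (ball z R) w *\<^sub>R G w) \<in> borel_measurable borel"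
    by (intro borel_measurable_scaleR borel_measurable_indicator G) simp
  have "(LINT w:((\<lambda>u. z + u) ` disc R)|lebesgue. G w) = (LINT w|lborel. indicator (ball z R) w *\<^sub>R G w)"
    unfolding image set_lebesgue_integral_def using meas by (intro integral_completion) simp
  also have "\<dots> = (LINT w|distr lborel borel ((+) z). indicator (ball z R) w *\<^sub>R G w)"
    by (simp only: lborel_distr_plus)
  also have "\<dots> = (LINT u|lborel. indicator (ball z R) (z + u) *\<^sub>R G (z + u))"
    using meas by (subst integral_distr) auto
  also have "\<dots> = (LINT u|lborel. indicator (ball 0 R) u * G (z + u))"
    by (rule Bochner_Integration.integral_cong) (auto simp: indicator_def dist_norm)
  finally show ?thesis .
qed

section \<open>The reproducing formula\<close>

theorem theorem1:
  fixes R :: real and r j :: nat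
  assumes "R > 0"
  shows "(local_const j r R \<noteq> 0 \<longrightarrow>
           (\<forall>f\<in>L2. \<forall>z. stft (hermite_fun r) f z =
              inverse (local_const j r R) *
              (LINT w:((\<lambda>u. z + u) ` disc R)|lebesgue.
                 stft (hermite_fun r) f w * stft_kernel (hermite_fun j) z w)))
       \<and> local_const j r R =
           complex_of_real (LINT t:{0..pi * R\<^sup>2}|lebesgue. laguerre r t * laguerre j t * exp (- t))"
proof (intro conjI impI ballI allI)
  have "(LINT t:{0..pi * R\<^sup>2}|lebesgue. laguerre r t * laguerre j t * exp (- t)) = disc_const j r R"
    unfolding set_lebesgue_integral_def disc_const_def real_scaleR_def
    by (rule integral_completion) measurable
  then show "local_const j r R = complex_of_real (LINT t:{0..pi * R\<^sup>2}|lebesgue. laguerre r t * laguerre j t * exp (- t))"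
    by (simp add: local_const_eq[OF assms])
next
  fix f :: "real \<Rightarrow> complex" and z :: "real \<times> real"
  assume nz: "local_const j r R \<noteq> 0" and f: "f \<in> L2"
  obtain f' where f': "f' \<in> borel_measurable borel" "integrable lborel (\<lambda>x. (cmod (f' x))\<^sup>2)" "AE x in lebesgue. f x = f' x"
    using L2_borel_representative[OF f] .
  have "f' \<in> borel_measurable lebesgue"
    using f'(1) by (intro measurable_completion) simp
  then have eq: "stft (hermite_fun r) f w = stft (hermite_fun r) f' w" for w
    using f f'(3) by (intro stft_cong_AE) (auto simp: L2_def)
  have kernel: "stft_kernel (hermite_fun j) z = (\<lambda>w. exp (2 * pi * \<i> * of_real (snd (w - z) * fst z)) * L2_inner (tf_shift (w - z) (hermite_fun j)) (hermite_fun j))"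
    using stft_kernel_hermite[of j z "_ - z"] by (auto simp: fun_eq_iff)
  have "stft_kernel (hermite_fun j) z \<in> borel_measurable borel"
    unfolding kernel by (intro borel_measurable_continuous_onI continuous_intros)
  then have meas: "(\<lambda>w. stft (hermite_fun r) f' w * stft_kernel (hermite_fun j) z w) \<in> borel_measurable borel"
    using borel_measurable_stft[OF f'(1)] by (intro borel_measurable_times)
  have "(LINT w:((\<lambda>u. z + u) ` disc R)|lebesgue. stft (hermite_fun r) f w * stft_kernel (hermite_fun j) z w) =
      local_const j r R * stft (hermite_fun r) f z"
    unfolding eq set_integral_translated_disc[OF meas] stft_disc_reproduction[OF f'(1,2) assms] local_const_eq[OF assms] ..
  then show "stft (hermite_fun r) f z = inverse (local_const j r R) *
      (LINT w:((\<lambda>u. z + u) ` disc R)|lebesgue. stft (hermite_fun r) f w * stft_kernel (hermite_fun j) z w)"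
    using nz by simp
qed

end
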